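(* Let $\mathcal F\in\{\mathcal L,\mathcal C\}$, where $\mathcal L$ is the species of linear orders and $\mathcal C$ the species of cyclic permutations, and let $\mathcal A$ be a gargantuan (weighted) species of structures that can be represented as $\mathcal A=\mathcal F\circ\mathcal B$ for some (weighted) species of structures $\mathcal B$. Let $m,n\in\mathbb Z_{\ge0}$ and let $s\in\mathcal A$ be a random $\mathcal A$-structure on $[n]$. Then, with $m$ fixed and $n\to\infty$, $$\mathbb P(s\in\mathcal F_m\circ\mathcal B)\approx\sum_{k\ge0}\mathfrak d_{k,m}(\mathcal F)\cdot\binom nk\cdot\frac{\mathfrak a_{n-k}}{\mathfrak a_n},$$ where $\mathfrak a_n$, $\mathfrak d_{n,m}(\mathcal L)$ and $\mathfrak d_{n,m}(\mathcal C)$ are the total weights on the set $[n]$ of the (virtual) species $\mathcal A$, $m\,\mathcal B^{m-1}(\mathbf 1-\mathcal B)^2$ and $\mathcal B^{m-1}(\mathbf 1-\mathcal B)$, respectively.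
   Context: A species of structures $F$ assigns to each finite set $U$ a finite set $F[U]$ and to each bijection $\sigma:U\to V$ a map $F[\sigma]:F[U]\to F[V]$, functorially. In a weighted species every structure carries a weight $w(s)$ preserved by transport (and $F[U]$ is finite or summable); here weights are positive real numbers. An unweighted species has all weights $1$. Write $[n]=\{1,\dots,n\}$, $[0]=\emptyset$. The total weight of $F$ on $[n]$ is $\sum_{s\in F[[n]]}w(s)$, and $F(z)=\sum_n(\text{total weight on }[n])z^n/n!$. A random $F$-structure on $[n]$ equals $s$ with probability $w(s)$ divided by the total weight on $[n]$. Equality of species means (weight-preserving) isomorphism. $\mathcal L[U]$ is the set of linear orders on $U$ (including one on $\emptyset$); $\mathcal C[U]$ is the set of permutations of $U$ consisting of a single cycle (none for $U=\emptyset$). $\mathcal F_m$ is the restriction of $\mathcal F$ to sets of cardinality $m$. For $\mathcal B$ with $\mathcal B[\emptyset]=\emptyset$, an $(\mathcal F\circ\mathcal B)$-structure on $U$ consists of a partition $\pi$ of $U$ into nonempty blocks, an $\mathcal F$-structure on the set $\pi$, and a $\mathcal B$-structure on each block; weights multiply. $\mathbf 1$ is the species with a single structure (of weight 1), on the empty set only. The product $F\cdot G$ is the species of ordered pairs (an $F$-structure on $U_1$, a $G$-structure on $U_2$) with $U_1\sqcup U_2=U$, weights multiplying. Virtual species are formal differences of species, and total weights extend linearly. Thus for $m\ge1$ the exponential generating series of $(\mathfrak d_{n,m}(\mathcal L))_n$ and $(\mathfrak d_{n,m}(\mathcal C))_n$ are $m\mathcal B(z)^{m-1}(1-\mathcal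 B(z))^2$ and $\mathcal B(z)^{m-1}(1-\mathcal B(z))$. For $m=0$ both species are taken to be empty, so $\mathfrak d_{n,0}(\mathcal F)=0$. A sequence $(a_n)$ of real numbers with $a_n\ne0$ for all but finitely many $n$ is gargantuan if (i) $a_{n-1}/a_n\to0$ as $n\to\infty$ and (ii) for each $r\in\mathbb Z_{\ge0}$, $\sum_{k=r}^{n-r}|a_ka_{n-k}|=O(a_{n-r})$. $\mathcal A$ is gargantuan if $(\mathfrak a_n/n!)$ is gargantuan. Notation $\approx$: $p_n\approx\sum_{k\ge0}c_kg_k(n)$ (here $g_k(n)=\binom nk\mathfrak a_{n-k}/\mathfrak a_n$, for large $n$) means that $g_{k+1}(n)=o(g_k(n))$ for every $k$ and, for every integer $r\ge0$, $p_n=\sum_{k=0}^rc_kg_k(n)+O(g_{r+1}(n))$ as $n\to\infty$. *)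

theory Defs
  imports
    "HOL-Analysis.Infinite_Sum"
    "HOL-Probability.Probability_Mass_Function"
    "HOL-Library.Landau_Symbols"
    "HOL-Library.Disjoint_Sets"
    "HOL-Combinatorics.Orbits"
begin

section \<open>Weighted species\<close>

text \<open>
  A species is given on the finite subsets of a label type \<open>'a\<close>, with values in a structure
  type \<open>'s\<close>. For an infinite label type such as \<^typ>\<open>nat\<close> this loses nothing, since every
  finite set is in bijection with a finite subset of it. If \<open>\<sigma>\<close> is injective on \<open>U\<close>, then
  \<open>transp F U \<sigma>\<close> is the transport \<open>F[U] \<rightarrow> F[\<sigma>(U)]\<close> along the bijection that \<open>\<sigma>\<close> induces
  from \<open>U\<close> onto \<open>\<sigma> ` U\<close>. Structures on different sets may be represented by the same value, so
  transport and weight take the underlying set as an argument.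
\<close>

record ('a, 's) species =
  strs :: "'a set \<Rightarrow> 's set"
  transp :: "'a set \<Rightarrow> ('a \<Rightarrow> 'a) \<Rightarrow> 's \<Rightarrow> 's"
  wt :: "'a set \<Rightarrow> 's \<Rightarrow> real"

text \<open>
  The sets \<open>F[U]\<close> may be infinite as long as the weights are summable. The second transport axiom
  says that transport along \<open>\<sigma>\<close> depends only on the restriction of \<open>\<sigma>\<close> to \<open>U\<close>.
\<close>

definition weighted_species :: "('a, 's) species \<Rightarrow> bool" where
  "weighted_species F \<longleftrightarrow>
     (\<forall>U. finite U \<longrightarrow> wt F U summable_on strs F U \<and> (\<forall>s\<in>strs F U. wt F U s > 0)) \<and>
     (\<forall>U \<sigma> \<tau> s. finite U \<and> inj_on \<sigma> U \<and> (\<forall>x\<in>U. \<sigma> x = \<tau> x) \<and> s \<in> strs F U \<longrightarrow>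
        transp F U \<sigma> s = transp F U \<tau> s) \<and>
     (\<forall>U \<sigma> s. finite U \<and> inj_on \<sigma> U \<and> s \<in> strs F U \<longrightarrow>
        transp F U \<sigma> s \<in> strs F (\<sigma> ` U) \<and> wt F (\<sigma> ` U) (transp F U \<sigma> s) = wt F U s) \<and>
     (\<forall>U s. finite U \<and> s \<in> strs F U \<longrightarrow> transp F U id s = s) \<and>
     (\<forall>U \<sigma> \<tau> s. finite U \<and> inj_on \<sigma> U \<and> inj_on \<tau> (\<sigma> ` U) \<and> s \<in> strs F U \<longrightarrow>
        transp F U (\<tau> \<circ> \<sigma>) s = transp F (\<sigma> ` U) \<tau> (transp F U \<sigma> s))"

definition species_iso ::
    "('a set \<Rightarrow> 's \<Rightarrow> 't) \<Rightarrow> ('a, 's) species \<Rightarrow> ('a, 't) species \<Rightarrow> bool" where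
  "species_iso \<phi> F G \<longleftrightarrow>
     (\<forall>U. finite U \<longrightarrow>
        bij_betw (\<phi> U) (strs F U) (strs G U) \<and>
        (\<forall>s\<in>strs F U. wt G U (\<phi> U s) = wt F U s) \<and>
        (\<forall>\<sigma>. inj_on \<sigma> U \<longrightarrow>
           (\<forall>s\<in>strs F U. \<phi> (\<sigma> ` U) (transp F U \<sigma> s) = transp G U \<sigma> (\<phi> U s))))"

definition total_weight :: "(nat, 's) species \<Rightarrow> nat \<Rightarrow> real" where
  "total_weight F n = (\<Sum>\<^sub>\<infinity>s\<in>strs F {1..n}. wt F {1..n} s)"

text \<open>Only meaningful if the total weight on \<open>{1..n}\<close> is nonzero.\<close>

definition random_structure :: "(nat, 's) species \<Rightarrow> nat \<Rightarrow> 's pmf" where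
  "random_structure F n =
     embed_pmf (\<lambda>s. if s \<in> strs F {1..n} then wt F {1..n} s / total_weight F n else 0)"


section \<open>Linear orders and cyclic permutations\<close>

text \<open>Linear orders are reflexive relations, as in \<^const>\<open>linear_order_on\<close>.\<close>

definition lin_species :: "('a, 'a rel) species" where
  "lin_species =
     \<lparr> strs = (\<lambda>U. {r. linear_order_on U r}),
       transp = (\<lambda>U \<sigma> r. map_prod \<sigma> \<sigma> ` r),
       wt = (\<lambda>U r. 1) \<rparr>"

text \<open>
  A permutation of \<open>U\<close> is a function on the whole label type that is the identity outside \<open>U\<close>.
  The predicate \<^const>\<open>cyclic_on\<close> fails on the empty set, and a fixed point is a cycle of
  length 1.
\<close>

definition cyc_species :: "('a, 'a \<Rightarrow> 'a) species" where
  "cyc_species =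
     \<lparr> strs = (\<lambda>U. {p. p permutes U \<and> cyclic_on p U}),
       transp = (\<lambda>U \<sigma> p y. if y \<in> \<sigma> ` U then \<sigma> (p (inv_into U \<sigma> y)) else y),
       wt = (\<lambda>U p. 1) \<rparr>"


section \<open>Operations on species\<close>

definition restr_species :: "nat \<Rightarrow> ('a, 's) species \<Rightarrow> ('a, 's) species" where
  "restr_species m F =
     \<lparr> strs = (\<lambda>U. if finite U \<and> card U = m then strs F U else {}),
       transp = transp F,
       wt = wt F \<rparr>"

text \<open>
  An \<open>(F \<circ> B)\<close>-structure on \<open>U\<close> is a triple \<open>(\<pi>, f, \<beta>)\<close> in which \<open>\<beta>\<close> chooses a
  \<open>B\<close>-structure on each block of \<open>\<pi>\<close>. The labels of \<open>F\<close> are the blocks, so its label type is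
  \<open>'a set\<close>. Composition is only meaningful when \<open>strs B {} = {}\<close>.
\<close>

definition comp_species ::
    "('a set, 'f) species \<Rightarrow> ('a, 'b) species \<Rightarrow>
     ('a, 'a set set \<times> 'f \<times> ('a set \<Rightarrow> 'b)) species" where
  "comp_species F B =
     \<lparr> strs = (\<lambda>U. {(\<pi>, f, \<beta>). partition_on U \<pi> \<and> f \<in> strs F \<pi> \<and>
                       \<beta> \<in> (\<Pi>\<^sub>E X\<in>\<pi>. strs B X)}),
       transp = (\<lambda>U \<sigma> (\<pi>, f, \<beta>).
         let \<pi>' = image \<sigma> ` \<pi>
         in (\<pi>', transp F \<pi> (image \<sigma>) f,
             \<lambda>Y\<in>\<pi>'. let X = inv_into \<pi> (image \<sigma>) Y in transp B X \<sigma> (\<beta> X))),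
       wt = (\<lambda>U (\<pi>, f, \<beta>). wt F \<pi> f * (\<Prod>X\<in>\<pi>. wt B X (\<beta> X))) \<rparr>"

definition one_species :: "('a, unit) species" where
  "one_species =
     \<lparr> strs = (\<lambda>U. if U = {} then {()} else {}), transp = (\<lambda>U \<sigma> s. s), wt = (\<lambda>U s. 1) \<rparr>"

definition empty_species :: "('a, 's) species" where
  "empty_species = \<lparr> strs = (\<lambda>U. {}), transp = (\<lambda>U \<sigma> s. s), wt = (\<lambda>U s. 1) \<rparr>"

definition sum_species ::
    "('a, 's) species \<Rightarrow> ('a, 't) species \<Rightarrow> ('a, 's + 't) species" where
  "sum_species F G =
     \<lparr> strs = (\<lambda>U. strs F U <+> strs G U),
       transp = (\<lambda>U \<sigma>. map_sum (transp F U \<sigma>) (transp G U \<sigma>)),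
       wt = (\<lambda>U. case_sum (wt F U) (wt G U)) \<rparr>"

text \<open>Both factors are stored together with their underlying sets.\<close>

definition prod_species ::
    "('a, 's) species \<Rightarrow> ('a, 't) species \<Rightarrow>
     ('a, ('a set \<times> 's) \<times> ('a set \<times> 't)) species" where
  "prod_species F G =
     \<lparr> strs = (\<lambda>U. {((V, s), (W, t)). V \<inter> W = {} \<and> V \<union> W = U \<and>
                       s \<in> strs F V \<and> t \<in> strs G W}),
       transp = (\<lambda>U \<sigma> ((V, s), (W, t)).
         ((\<sigma> ` V, transp F V \<sigma> s), (\<sigma> ` W, transp G W \<sigma> t))),
       wt = (\<lambda>U ((V, s), (W, t)). wt F V s * wt G W t) \<rparr>"

text \<open>
  The power \<open>F\<^sup>k\<close> is the iterated product \<open>F \<cdot> (F \<cdot> (\<dots> \<cdot> \<one>))\<close>, with nested pairs flattened to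
  lists of length \<open>k\<close> so that its type does not depend on \<open>k\<close>.
\<close>

primrec pow_strs :: "('a, 's) species \<Rightarrow> nat \<Rightarrow> 'a set \<Rightarrow> ('a set \<times> 's) list set" where
  "pow_strs F 0 U = (if U = {} then {[]} else {})"
| "pow_strs F (Suc k) U =
     {(V, s) # xs | V W s xs. V \<inter> W = {} \<and> V \<union> W = U \<and> s \<in> strs F V \<and> xs \<in> pow_strs F k W}"

definition pow_species :: "('a, 's) species \<Rightarrow> nat \<Rightarrow> ('a, ('a set \<times> 's) list) species" where
  "pow_species F k =
     \<lparr> strs = pow_strs F k,
       transp = (\<lambda>U \<sigma>. map (\<lambda>(V, s). (\<sigma> ` V, transp F V \<sigma> s))),
       wt = (\<lambda>U xs. \<Prod>(V, s)\<leftarrow>xs. wt F V s) \<rparr>"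

text \<open>The sum of \<open>m\<close> disjoint copies of \<open>F\<close>.\<close>

definition scale_species :: "nat \<Rightarrow> ('a, 's) species \<Rightarrow> ('a, nat \<times> 's) species" where
  "scale_species m F =
     \<lparr> strs = (\<lambda>U. {..<m} \<times> strs F U),
       transp = (\<lambda>U \<sigma>. map_prod id (transp F U \<sigma>)),
       wt = (\<lambda>U (i, s). wt F U s) \<rparr>"


section \<open>Virtual species\<close>

text \<open>
  A pair \<open>(P, N)\<close> stands for the formal difference \<open>P - N\<close>. No quotient is taken: pairs with
  \<open>P + N' \<cong> P' + N\<close> represent the same virtual species and have the same total weights.
\<close>

type_synonym ('a, 'p, 'n) virtual_species = "('a, 'p) species \<times> ('a, 'n) species"

definition of_species :: "('a, 's) species \<Rightarrow> ('a, 's, 's) virtual_species" where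
  "of_species F = (F, empty_species)"

definition vprod ::
    "('a, 'p, 'n) virtual_species \<Rightarrow> ('a, 'q, 'o) virtual_species \<Rightarrow>
     ('a, (('a set \<times> 'p) \<times> ('a set \<times> 'q)) + (('a set \<times> 'n) \<times> ('a set \<times> 'o)),
          (('a set \<times> 'p) \<times> ('a set \<times> 'o)) + (('a set \<times> 'n) \<times> ('a set \<times> 'q)))
       virtual_species" where
  "vprod = (\<lambda>(P, N) (P', N').
     (sum_species (prod_species P P') (prod_species N N'),
      sum_species (prod_species P N') (prod_species N P')))"

definition vscale ::
    "nat \<Rightarrow> ('a, 'p, 'n) virtual_species \<Rightarrow> ('a, nat \<times> 'p, nat \<times> 'n) virtual_species" where
  "vscale m = (\<lambda>(P, N). (scale_species m P, scale_species m N))"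

definition vtotal_weight :: "(nat, 'p, 'n) virtual_species \<Rightarrow> nat \<Rightarrow> real" where
  "vtotal_weight = (\<lambda>(P, N) n. total_weight P n - total_weight N n)"

definition one_minus :: "('a, 's) species \<Rightarrow> ('a, unit, 's) virtual_species" where
  "one_minus B = (one_species, B)"

text \<open>
  The virtual species \<open>m B\<^sup>m\<^sup>-\<^sup>1 (\<one> - B)\<^sup>2\<close> and \<open>B\<^sup>m\<^sup>-\<^sup>1 (\<one> - B)\<close>, which are empty for \<open>m = 0\<close>.
  In the first one the factor \<open>m\<close> takes care of that case.
\<close>

definition d_lin :: "(nat, 's) species \<Rightarrow> nat \<Rightarrow> nat \<Rightarrow> real" where
  "d_lin B n m =
     vtotal_weight
       (vscale m (vprod (of_species (pow_species B (m - 1))) (vprod (one_minus B) (one_minus B)))) n"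

definition d_cyc :: "(nat, 's) species \<Rightarrow> nat \<Rightarrow> nat \<Rightarrow> real" where
  "d_cyc B n m =
     vtotal_weight
       (if m = 0 then (empty_species, empty_species)
        else vprod (of_species (pow_species B (m - 1))) (one_minus B)) n"


section \<open>Gargantuan sequences and asymptotic expansions\<close>

definition gargantuan :: "(nat \<Rightarrow> real) \<Rightarrow> bool" where
  "gargantuan a \<longleftrightarrow>
     (\<forall>\<^sub>F n in sequentially. a n \<noteq> 0) \<and>
     (\<lambda>n. a (n - 1) / a n) \<longlonglongrightarrow> 0 \<and>
     (\<forall>r. (\<lambda>n. \<Sum>k=r..n-r. \<bar>a k * a (n - k)\<bar>) \<in> O(\<lambda>n. a (n - r)))"

definition gargantuan_species :: "(nat, 's) species \<Rightarrow> bool" where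
  "gargantuan_species A \<longleftrightarrow> gargantuan (\<lambda>n. total_weight A n / fact n)"

definition asymp_expansion ::
    "(nat \<Rightarrow> real) \<Rightarrow> (nat \<Rightarrow> real) \<Rightarrow> (nat \<Rightarrow> nat \<Rightarrow> real) \<Rightarrow> bool" where
  "asymp_expansion p c g \<longleftrightarrow>
     (\<forall>k. g (Suc k) \<in> o(g k)) \<and>
     (\<forall>r. (\<lambda>n. p n - (\<Sum>k\<le>r. c k * g k n)) \<in> O(g (Suc r)))"

end

(*
  Let b(z) be the exponential generating series of B. Counting linear orders and cyclic permutations
  of the blocks of a partition shows that (F_m o B) has generating series b^m for F = L and b^m / m for
  F = C, so that A has generating series a = 1 / (1 - b) or a = -log (1 - b).

  Say that a sequence x has the expansion D if x_n = sum_{k <= r} D_k a_{n-k} + O(a_{n-r-1}) for all r,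
  where a_n now denotes the n-th coefficient of a. In a convolution of two sequences dominated by a, the
  gargantuan property makes all but the first and last r + 1 terms negligible, hence x |-> D behaves
  like a derivation. It sends b to db/da, which is (1 - b)^2 for L and 1 - b for C; this follows by
  strong induction on r from a (1 - b) = 1 and from a' (1 - b) = b', respectively. The Leibniz rule
  then gives m b^(m-1) db/da for b^m.
*)

theory Submission
  imports Defs "HOL-Computational_Algebra.Formal_Power_Series"
begin

section \<open>Expansions with respect to a gargantuan sequence\<close>

text \<open>The strong induction on the order needs an identity in which the unknown expansion of b
  enters only at lower order. In a (1 - b) = 1 the coefficient b_n is multiplied by a_0 = 1, so an
  end sum would involve the very order being proved. Moving that term across gives b (1 - a) = 1 - a
  + b: since 1 - a has no constant term, each b_(n-k) in the end sum has k >= 1 and is needed only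
  to order r - k. In the cyclic case z a' is the factor without constant term. No separate base case
  remains.

  The middle of a convolution is negligible only for factors dominated by a. The domination comes
  from positivity of the weights: if c_m is the m-th coefficient of 1 / (1 - z) or -log (1 - z),
  then c_m b^m is coefficientwise at most a. Index 0 is excluded from it, because a_0 = 0 in the
  cyclic case whereas b^0 has constant term 1.

  On the side of species, only nonnegative sums over all finite label sets are tracked; isomorphisms
  and transports enter just as weight-preserving bijections.\<close>

definition expansion :: "(nat \<Rightarrow> real) \<Rightarrow> nat \<Rightarrow> (nat \<Rightarrow> real) \<Rightarrow> (nat \<Rightarrow> real) \<Rightarrow> bool" where
  "expansion \<alpha> r x D \<longleftrightarrow> (\<lambda>n. x n - (\<Sum>i\<le>r. D i * \<alpha> (n - i))) \<in> O(\<lambda>n. \<alpha> (n - Suc r))"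

section \<open>Landau estimates and convolutions with a gargantuan sequence\<close>

lemma bigo_shift:
  fixes f g :: "nat \<Rightarrow> real"
  assumes "f \<in> O(g)"
  shows "(\<lambda>n. f (n - k)) \<in> O(\<lambda>n. g (n - k))"
  using landau_o.big.compose[OF assms filterlim_minus_const_nat_at_top[of k]] by simp

lemma smallo_shift:
  fixes f g :: "nat \<Rightarrow> real"
  assumes "f \<in> o(g)"
  shows "(\<lambda>n. f (n - k)) \<in> o(\<lambda>n. g (n - k))"
  using landau_o.small.compose[OF assms filterlim_minus_const_nat_at_top[of k]] by simp

lemma gargantuan_smallo_pred:
  assumes "gargantuan \<alpha>"
  shows "(\<lambda>n. \<alpha> (n - 1)) \<in> o(\<alpha>)"
  using assms unfolding gargantuan_def by (intro smalloI_tendsto) auto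

lemma gargantuan_smallo_Suc:
  assumes "gargantuan \<alpha>"
  shows "(\<lambda>n. \<alpha> (n - Suc k)) \<in> o(\<lambda>n. \<alpha> (n - k))"
  using smallo_shift[OF gargantuan_smallo_pred[OF assms], of k] by simp

text \<open>The terms with r < k < n - r are controlled by the second gargantuan condition at
  \<open>Suc r\<close>. The family \<open>f\<close> may depend on \<open>n\<close> as well, which
  leaves room for the factors 1 - k / n of the cyclic case.\<close>

lemma two_ended_sum:
  fixes f :: "nat \<Rightarrow> nat \<Rightarrow> real"
  assumes garg: "gargantuan \<alpha>"
    and bound: "\<And>n k. 1 \<le> k \<Longrightarrow> k < n \<Longrightarrow> \<bar>f n k\<bar> \<le> C * (\<alpha> k * \<alpha> (n - k))"
  shows "(\<lambda>n. (\<Sum>k\<le>n. f n k) - ((\<Sum>k\<le>r. f n k) + (\<Sum>k\<le>r. f n (n - k))))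
           \<in> O(\<lambda>n. \<alpha> (n - Suc r))"
proof -
  have "(\<lambda>n. (\<Sum>k\<le>n. f n k) - ((\<Sum>k\<le>r. f n k) + (\<Sum>k\<le>r. f n (n - k))))
          \<in> O(\<lambda>n. \<Sum>k=Suc r..n - Suc r. \<bar>\<alpha> k * \<alpha> (n - k)\<bar>)"
  proof (rule bigoI[of _ "\<bar>C\<bar>"], rule eventually_mono[OF eventually_ge_at_top[of "2 * r + 2"]])
    fix n :: nat assume n: "2 * r + 2 \<le> n"
    \<comment> \<open>From \<open>2 * r + 2\<close> on, the two ends and the middle are disjoint
      index ranges.\<close>
    have "{..n} = {..r} \<union> ({Suc r..n - Suc r} \<union> (\<lambda>k. n - k) ` {..r})"
    proof (intro equalityI subsetI)
      fix k assume "k \<in> {..n}"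
      then show "k \<in> {..r} \<union> ({Suc r..n - Suc r} \<union> (\<lambda>k. n - k) ` {..r})"
        by (cases "k \<le> n - Suc r") (auto intro!: image_eqI[of _ _ "n - k"])
    qed (use n in auto)
    then have "(\<Sum>k\<le>n. f n k)
        = (\<Sum>k\<in>{..r} \<union> ({Suc r..n - Suc r} \<union> (\<lambda>k. n - k) ` {..r}). f n k)" by simp
    also have "\<dots> = (\<Sum>k\<le>r. f n k) + ((\<Sum>k=Suc r..n - Suc r. f n k)
        + (\<Sum>k\<in>(\<lambda>k. n - k) ` {..r}. f n k))"
      using n by (subst sum.union_disjoint; (subst sum.union_disjoint)?; force)
    also have "(\<Sum>k\<in>(\<lambda>k. n - k) ` {..r}. f n k) = (\<Sum>k\<le>r. f n (n - k))"
      using n by (subst sum.reindex) (auto simp: inj_on_def)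
    finally have "(\<Sum>k\<le>n. f n k) - ((\<Sum>k\<le>r. f n k) + (\<Sum>k\<le>r. f n (n - k)))
        = (\<Sum>k=Suc r..n - Suc r. f n k)" by simp
    also have "\<bar>\<dots>\<bar> \<le> (\<Sum>k=Suc r..n - Suc r. \<bar>f n k\<bar>)" by (rule sum_abs)
    also have "\<dots> \<le> (\<Sum>k=Suc r..n - Suc r. \<bar>C\<bar> * \<bar>\<alpha> k * \<alpha> (n - k)\<bar>)"
    proof (rule sum_mono)
      fix k assume "k \<in> {Suc r..n - Suc r}"
      then have "\<bar>f n k\<bar> \<le> C * (\<alpha> k * \<alpha> (n - k))" using n by (intro bound) auto
      then show "\<bar>f n k\<bar> \<le> \<bar>C\<bar> * \<bar>\<alpha> k * \<alpha> (n - k)\<bar>"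
        using abs_mult[of C "\<alpha> k * \<alpha> (n - k)"] by linarith
    qed
    finally show "norm ((\<Sum>k\<le>n. f n k) - ((\<Sum>k\<le>r. f n k) + (\<Sum>k\<le>r. f n (n - k))))
        \<le> \<bar>C\<bar> * norm (\<Sum>k=Suc r..n - Suc r. \<bar>\<alpha> k * \<alpha> (n - k)\<bar>)"
      by (simp add: sum_distrib_left[symmetric])
  qed
  also have "(\<lambda>n. \<Sum>k=Suc r..n - Suc r. \<bar>\<alpha> k * \<alpha> (n - k)\<bar>) \<in> O(\<lambda>n. \<alpha> (n - Suc r))"
    using garg unfolding gargantuan_def by blast
  finally show ?thesis .
qed

text \<open>Expanding \<open>y (n - k)\<close> to order \<open>r - k\<close> already leaves an error
  of size \<open>\<alpha> (n - Suc r)\<close>. The expansion is demanded only where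
  \<open>fps_nth X k\<close> is nonzero, so that a factor with zero constant term avoids order
  \<open>r\<close> itself.\<close>

lemma expansion_end_sum:
  fixes X D :: "real fps"
  assumes exp: "\<And>k. k \<le> r \<Longrightarrow> fps_nth X k \<noteq> 0 \<Longrightarrow> expansion \<alpha> (r - k) y (fps_nth D)"
  shows "(\<lambda>n. (\<Sum>k\<le>r. fps_nth X k * y (n - k)) - (\<Sum>i\<le>r. fps_nth (X * D) i * \<alpha> (n - i)))
           \<in> O(\<lambda>n. \<alpha> (n - Suc r))"
proof -
  have *: "(\<lambda>n. fps_nth X k * (y (n - k) - (\<Sum>i\<le>r - k. fps_nth D i * \<alpha> (n - k - i))))
      \<in> O(\<lambda>n. \<alpha> (n - Suc r))" if "k \<le> r" for k
  proof (cases "fps_nth X k = 0")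
    case False
    have "(\<lambda>n. y (n - k) - (\<Sum>i\<le>r - k. fps_nth D i * \<alpha> (n - k - i)))
        \<in> O(\<lambda>n. \<alpha> (n - k - Suc (r - k)))"
      using bigo_shift[OF exp[OF that False, unfolded expansion_def], of k] .
    also have "(\<lambda>n. \<alpha> (n - k - Suc (r - k))) = (\<lambda>n. \<alpha> (n - Suc r))"
      using that by simp
    finally show ?thesis by simp
  qed simp
  have "(\<lambda>n. \<Sum>k\<le>r. fps_nth X k * (y (n - k) - (\<Sum>i\<le>r - k. fps_nth D i * \<alpha> (n - k - i))))
      \<in> O(\<lambda>n. \<alpha> (n - Suc r))"
    by (rule big_sum_in_bigo) (use * in auto)
  also have "(\<lambda>n. \<Sum>k\<le>r. fps_nth X k * (y (n - k) - (\<Sum>i\<le>r - k. fps_nth D i * \<alpha> (n - k - i))))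
      = (\<lambda>n. (\<Sum>k\<le>r. fps_nth X k * y (n - k)) - (\<Sum>i\<le>r. fps_nth (X * D) i * \<alpha> (n - i)))"
  proof
    fix n
    have "(\<Sum>i\<le>r. fps_nth (X * D) i * \<alpha> (n - i))
        = (\<Sum>i\<le>r. \<Sum>k\<le>i. fps_nth X k * (fps_nth D (i - k) * \<alpha> (n - k - (i - k))))"
      by (auto simp: fps_mult_nth sum_distrib_right atLeast0AtMost mult.assoc intro!: sum.cong)
    also have "\<dots> = (\<Sum>k\<le>r. \<Sum>i\<le>r - k. fps_nth X k * (fps_nth D i * \<alpha> (n - k - i)))"
      by (simp add: sum.Sigma)
         (rule sum.reindex_bij_witness[of _ "\<lambda>(k, i). (k + i, k)" "\<lambda>(i, k). (k, i - k)"]; auto)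
    finally show "(\<Sum>k\<le>r. fps_nth X k * (y (n - k) - (\<Sum>i\<le>r - k. fps_nth D i * \<alpha> (n - k - i))))
        = (\<Sum>k\<le>r. fps_nth X k * y (n - k)) - (\<Sum>i\<le>r. fps_nth (X * D) i * \<alpha> (n - i))"
      by (simp add: sum_subtractf right_diff_distrib sum_distrib_left)
  qed
  finally show ?thesis .
qed

text \<open>Near k = 0 the factor \<open>Y\<close> is expanded, near k = n the factor
  \<open>X\<close>; the two end sums give the two terms of the Leibniz rule.\<close>

lemma expansion_mult:
  fixes X Y D E :: "real fps"
  assumes garg: "gargantuan \<alpha>"
    and X: "\<And>n. n \<ge> 1 \<Longrightarrow> \<bar>fps_nth X n\<bar> \<le> C * \<alpha> n" "\<And>r. expansion \<alpha> r (fps_nth X) (fps_nth D)"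
    and Y: "\<And>n. n \<ge> 1 \<Longrightarrow> \<bar>fps_nth Y n\<bar> \<le> C' * \<alpha> n" "\<And>r. expansion \<alpha> r (fps_nth Y) (fps_nth E)"
  shows "expansion \<alpha> r (fps_nth (X * Y)) (fps_nth (X * E + Y * D))"
proof -
  have "\<bar>fps_nth X k * fps_nth Y (n - k)\<bar> \<le> C * C' * (\<alpha> k * \<alpha> (n - k))" if "1 \<le> k" "k < n" for n k
  proof -
    have "\<bar>fps_nth X k * fps_nth Y (n - k)\<bar> \<le> (C * \<alpha> k) * (C' * \<alpha> (n - k))"
      unfolding abs_mult using that X(1)[of k] Y(1)[of "n - k"] by (intro mult_mono) (auto intro: order_trans[OF abs_ge_zero])
    then show ?thesis by (simp add: mult_ac)
  qed
  note two = two_ended_sum[OF garg this, of r]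
  have "(\<lambda>n. ((\<Sum>k\<le>n. fps_nth X k * fps_nth Y (n - k))
          - ((\<Sum>k\<le>r. fps_nth X k * fps_nth Y (n - k)) + (\<Sum>k\<le>r. fps_nth X (n - k) * fps_nth Y (n - (n - k)))))
        + ((\<Sum>k\<le>r. fps_nth X k * fps_nth Y (n - k)) - (\<Sum>i\<le>r. fps_nth (X * E) i * \<alpha> (n - i)))
        + ((\<Sum>k\<le>r. fps_nth Y k * fps_nth X (n - k)) - (\<Sum>i\<le>r. fps_nth (Y * D) i * \<alpha> (n - i))))
      \<in> O(\<lambda>n. \<alpha> (n - Suc r))" (is "?f \<in> _")
    by (intro sum_in_bigo two expansion_end_sum X(2) Y(2))
  also have "?f \<in> O(\<lambda>n. \<alpha> (n - Suc r)) \<longleftrightarrow> expansion \<alpha> r (fps_nth (X * Y)) (fps_nth (X * E + Y * D))"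
    unfolding expansion_def
  proof (rule landau_o.big.in_cong, rule eventually_mono[OF eventually_ge_at_top[of r]])
    fix n assume "r \<le> n"
    then have "(\<Sum>k\<le>r. fps_nth X (n - k) * fps_nth Y (n - (n - k))) = (\<Sum>k\<le>r. fps_nth Y k * fps_nth X (n - k))"
      by (intro sum.cong) auto
    then show "?f n = fps_nth (X * Y) n - (\<Sum>i\<le>r. fps_nth (X * E + Y * D) i * \<alpha> (n - i))"
      by (simp add: fps_mult_nth[of X Y] atLeast0AtMost distrib_right sum.distrib)
  qed
  finally show ?thesis .
qed

lemma expansion_cmult:
  fixes X D :: "real fps"
  assumes "expansion \<alpha> r (fps_nth X) (fps_nth D)"
  shows "expansion \<alpha> r (fps_nth (fps_const c * X)) (fps_nth (fps_const c * D))"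
proof -
  have "(\<lambda>n. c * (fps_nth X n - (\<Sum>i\<le>r. fps_nth D i * \<alpha> (n - i)))) \<in> O(\<lambda>n. \<alpha> (n - Suc r))"
    using assms unfolding expansion_def by (cases "c = 0") simp_all
  then show ?thesis
    by (simp add: expansion_def right_diff_distrib sum_distrib_left mult.assoc)
qed

text \<open>The bound is asked of every power because the induction multiplies \<open>B\<close> by
  \<open>B ^ m\<close>, and both factors have to be dominated by \<open>\<alpha>\<close>. At m = 0
  the factor \<open>of_nat m\<close> hides the truncated exponent.\<close>

lemma expansion_power:
  fixes B E :: "real fps"
  assumes garg: "gargantuan \<alpha>"
    and bound: "\<And>m. \<exists>C. \<forall>n\<ge>1. \<bar>fps_nth (B ^ m) n\<bar> \<le> C * \<alpha> n"
    and B: "\<And>r. expansion \<alpha> r (fps_nth B) (fps_nth E)"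
  shows "expansion \<alpha> r (fps_nth (B ^ m)) (fps_nth (of_nat m * B ^ (m - 1) * E))"
proof (induction m arbitrary: r)
  case 0
  have "(\<lambda>n. fps_nth (1 :: real fps) n) \<in> O(\<lambda>n. \<alpha> (n - Suc r))"
    by (rule bigoI[of _ 0], rule eventually_mono[OF eventually_ge_at_top[of 1]]) auto
  then show ?case by (simp add: expansion_def)
next
  case (Suc m)
  obtain C C' where "\<forall>n\<ge>1. \<bar>fps_nth (B ^ 1) n\<bar> \<le> C * \<alpha> n" "\<forall>n\<ge>1. \<bar>fps_nth (B ^ m) n\<bar> \<le> C' * \<alpha> n"
    using bound by metis
  then have "expansion \<alpha> r (fps_nth (B * B ^ m)) (fps_nth (B * (of_nat m * B ^ (m - 1) * E) + B ^ m * E))"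
    by (intro expansion_mult[OF garg _ B _ Suc.IH, of C C']) auto
  also have "B * (of_nat m * B ^ (m - 1) * E) + B ^ m * E = of_nat (Suc m) * B ^ (Suc m - 1) * E"
    by (cases m) (simp_all add: algebra_simps)
  finally show ?case by simp
qed

section \<open>Expansions of b from its functional equations\<close>

text \<open>In the convolution of \<open>B\<close> with \<open>1 - A\<close>, the low end is exactly
  minus the sum of the products of \<open>fps_nth B i\<close> and \<open>fps_nth A (n - i)\<close>.
  The high end contributes the coefficients of (1 - A) (1 - B)^2 = (1 - B)^2 - 1 + B. The two
  contributions of \<open>B\<close> cancel.\<close>

lemma expansion_inverse_one_minus:
  fixes A B :: "real fps"
  assumes garg: "gargantuan (fps_nth A)"
    and pos: "\<And>n. fps_nth B n \<ge> 0" "\<And>n. fps_nth B n \<le> fps_nth A n"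
    and A: "A * (1 - B) = 1" and B0: "fps_nth B 0 = 0"
  shows "expansion (fps_nth A) r (fps_nth B) (fps_nth ((1 - B)\<^sup>2))"
proof (induction r rule: less_induct)
  case (less r)
  let ?\<alpha> = "fps_nth A" and ?\<beta> = "fps_nth B"
  let ?P = "1 - A"
  have bound: "\<bar>?\<beta> k * fps_nth ?P (n - k)\<bar> \<le> 1 * (?\<alpha> k * ?\<alpha> (n - k))" if "1 \<le> k" "k < n" for n k
  proof -
    have "\<bar>?\<beta> k * fps_nth ?P (n - k)\<bar> = ?\<beta> k * ?\<alpha> (n - k)"
      using that pos[of "n - k"] pos(1)[of k] by (simp add: abs_mult)
    also have "\<dots> \<le> ?\<alpha> k * ?\<alpha> (n - k)"
      using pos[of k] pos[of "n - k"] by (intro mult_right_mono) auto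
    finally show ?thesis by simp
  qed
  have A0: "fps_nth A 0 = 1" using arg_cong[OF A, of "\<lambda>f. fps_nth f 0"] B0 by simp
  have "(\<lambda>n. ((\<Sum>k\<le>n. ?\<beta> k * fps_nth ?P (n - k))
          - ((\<Sum>k\<le>r. ?\<beta> k * fps_nth ?P (n - k)) + (\<Sum>k\<le>r. ?\<beta> (n - k) * fps_nth ?P (n - (n - k)))))
        + ((\<Sum>k\<le>r. fps_nth ?P k * ?\<beta> (n - k)) - (\<Sum>i\<le>r. fps_nth (?P * (1 - B)\<^sup>2) i * ?\<alpha> (n - i))))
      \<in> O(\<lambda>n. ?\<alpha> (n - Suc r))" (is "?f \<in> _")
  proof (rule sum_in_bigo(1)[OF two_ended_sum[OF garg bound] expansion_end_sum])
    \<comment> \<open>The constant term of \<open>?P\<close> is 0, so \<open>k\<close> is positive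
      and the induction hypothesis covers the order \<open>r - k\<close>.\<close>
    fix k assume "k \<le> r" "fps_nth ?P k \<noteq> 0"
    then show "expansion ?\<alpha> (r - k) ?\<beta> (fps_nth ((1 - B)\<^sup>2))"
      using A0 by (intro less.IH) (cases k; auto)
  qed
  also have "?f \<in> O(\<lambda>n. ?\<alpha> (n - Suc r)) \<longleftrightarrow> expansion ?\<alpha> r ?\<beta> (fps_nth ((1 - B)\<^sup>2))"
    unfolding expansion_def
  proof (rule landau_o.big.in_cong, rule eventually_mono[OF eventually_ge_at_top[of "Suc r"]])
    fix n assume n: "Suc r \<le> n"
    then have 1: "(\<Sum>k\<le>r. ?\<beta> (n - k) * fps_nth ?P (n - (n - k))) = (\<Sum>k\<le>r. fps_nth ?P k * ?\<beta> (n - k))"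
      by (intro sum.cong) auto
    \<comment> \<open>Here \<open>n - k\<close> is positive, so the summand 1 of \<open>?P\<close>
      does not contribute.\<close>
    have 2: "(\<Sum>k\<le>r. ?\<beta> k * fps_nth ?P (n - k)) = - (\<Sum>i\<le>r. ?\<beta> i * ?\<alpha> (n - i))"
      using n by (auto simp: sum_negf[symmetric] intro!: sum.cong)
    have BP: "B * ?P = 1 - A + B" using A by (simp add: algebra_simps)
    have 3: "(\<Sum>k\<le>n. ?\<beta> k * fps_nth ?P (n - k)) = ?\<beta> n - ?\<alpha> n"
      using arg_cong[OF BP, of "\<lambda>f. fps_nth f n"] n by (simp add: fps_mult_nth atLeast0AtMost)
    have "?P * (1 - B)\<^sup>2 = (1 - B)\<^sup>2 - (A * (1 - B)) * (1 - B)"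
      by (simp add: algebra_simps power2_eq_square)
    then have P2: "?P * (1 - B)\<^sup>2 = (1 - B)\<^sup>2 - 1 + B" using A by simp
    have 4: "(\<Sum>i\<le>r. fps_nth (?P * (1 - B)\<^sup>2) i * ?\<alpha> (n - i))
        = (\<Sum>i\<le>r. fps_nth ((1 - B)\<^sup>2) i * ?\<alpha> (n - i)) - ?\<alpha> n + (\<Sum>i\<le>r. ?\<beta> i * ?\<alpha> (n - i))"
      unfolding P2 by (simp add: algebra_simps sum.distrib sum_subtractf del: fps_one_nth)
        (simp add: if_distrib[of "\<lambda>t. t * _"] sum.delta cong: if_cong)
    show "?f n = ?\<beta> n - (\<Sum>i\<le>r. fps_nth ((1 - B)\<^sup>2) i * ?\<alpha> (n - i))"
      unfolding 1 2 3 4 by simp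
  qed
  finally show ?case .
qed

text \<open>
  Comparing coefficients in \<open>z B' = (1 - B) z A'\<close> introduces factors \<open>k / n\<close>. The end terms
  that carry them cancel up to the error term, because the induction hypothesis evaluates the sum of
  the \<open>k \<alpha>\<^sub>k \<beta>\<^sub>n\<^sub>-\<^sub>k\<close> through the coefficients \<open>i \<beta>\<^sub>i\<close> of \<open>z A' (1 - B)\<close>.
\<close>

lemma expansion_log:
  fixes A B :: "real fps"
  assumes garg: "gargantuan (fps_nth A)"
    and pos: "\<And>n. fps_nth B n \<ge> 0" "\<And>n. fps_nth B n \<le> fps_nth A n"
    and A: "fps_deriv A * (1 - B) = fps_deriv B" and B0: "fps_nth B 0 = 0"
  shows "expansion (fps_nth A) r (fps_nth B) (fps_nth (1 - B))"
proof (induction r rule: less_induct)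
  case (less r)
  let ?\<alpha> = "fps_nth A" and ?\<beta> = "fps_nth B" and ?\<gamma> = "fps_nth (1 - B)"
  let ?Z = "fps_X * fps_deriv A"
  define f where "f = (\<lambda>n k. ?\<gamma> k * ((1 - real k / real n) * ?\<alpha> (n - k)))"
  have bound: "\<bar>f n k\<bar> \<le> 1 * (?\<alpha> k * ?\<alpha> (n - k))" if "1 \<le> k" "k < n" for n k
  proof -
    have "\<bar>f n k\<bar> = ?\<beta> k * ((1 - real k / real n) * ?\<alpha> (n - k))"
      using that pos[of "n - k"] pos(1)[of k] by (simp add: f_def abs_mult)
    also have "\<dots> \<le> ?\<alpha> k * (1 * ?\<alpha> (n - k))"
      using pos[of k] pos[of "n - k"] that by (intro mult_mono mult_right_mono) auto
    finally show ?thesis by simp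
  qed
  have Z: "fps_nth ?Z k = real k * ?\<alpha> k" for k by (cases k) simp_all
  have ZB: "?Z * (1 - B) = fps_X * fps_deriv B" using A by (simp add: mult.assoc)
  have ZB': "fps_nth (?Z * (1 - B)) i = real i * ?\<beta> i" for i unfolding ZB by (cases i) simp_all
  have 0: "(\<lambda>n. (\<Sum>k\<le>r. fps_nth ?Z k * ?\<beta> (n - k)) - (\<Sum>i\<le>r. fps_nth (?Z * (1 - B)) i * ?\<alpha> (n - i)))
      \<in> O(\<lambda>n. ?\<alpha> (n - Suc r))"
  proof (intro expansion_end_sum)
    fix k assume "k \<le> r" "fps_nth ?Z k \<noteq> 0"
    then show "expansion ?\<alpha> (r - k) ?\<beta> ?\<gamma>"
      by (intro less.IH) (cases k; auto)
  qed
  have "(\<lambda>n. (1 / real n) * ((\<Sum>k\<le>r. fps_nth ?Z k * ?\<beta> (n - k)) - (\<Sum>i\<le>r. fps_nth (?Z * (1 - B)) i * ?\<alpha> (n - i))))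
      \<in> O(\<lambda>n. 1 * ?\<alpha> (n - Suc r))"
    by (rule landau_o.big.mult[OF _ 0], rule bigoI[of _ 1], rule eventually_mono[OF eventually_ge_at_top[of 1]]) auto
  then have 1: "(\<lambda>n. (1 / real n) * ((\<Sum>k\<le>r. fps_nth ?Z k * ?\<beta> (n - k)) - (\<Sum>i\<le>r. fps_nth (?Z * (1 - B)) i * ?\<alpha> (n - i))))
      \<in> O(\<lambda>n. ?\<alpha> (n - Suc r))" by simp
  have "(\<lambda>n. ((\<Sum>k\<le>n. f n k) - ((\<Sum>k\<le>r. f n k) + (\<Sum>k\<le>r. f n (n - k))))
        - (1 / real n) * ((\<Sum>k\<le>r. fps_nth ?Z k * ?\<beta> (n - k)) - (\<Sum>i\<le>r. fps_nth (?Z * (1 - B)) i * ?\<alpha> (n - i))))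
      \<in> O(\<lambda>n. ?\<alpha> (n - Suc r))" (is "?f \<in> _")
    by (rule sum_in_bigo(2)[OF two_ended_sum[OF garg bound] 1])
  also have "?f \<in> O(\<lambda>n. ?\<alpha> (n - Suc r)) \<longleftrightarrow> expansion ?\<alpha> r ?\<beta> ?\<gamma>"
    unfolding expansion_def
  proof (rule landau_o.big.in_cong, rule eventually_mono[OF eventually_ge_at_top[of "Suc r"]])
    fix n assume n: "Suc r \<le> n"
    have 2: "(\<Sum>k\<le>r. f n (n - k)) = - (1 / real n) * (\<Sum>k\<le>r. fps_nth ?Z k * ?\<beta> (n - k))"
      using n unfolding sum_distrib_left f_def Z by (intro sum.cong) (auto simp: of_nat_diff field_simps)
    have 3: "(\<Sum>k\<le>r. f n k) = (\<Sum>i\<le>r. ?\<gamma> i * ?\<alpha> (n - i))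
        + (1 / real n) * (\<Sum>i\<le>r. fps_nth (?Z * (1 - B)) i * ?\<alpha> (n - i))"
      unfolding sum_distrib_left f_def ZB' sum.distrib[symmetric]
      using n by (intro sum.cong) (auto simp: field_simps B0)
    have "real n * (\<Sum>k\<le>n. f n k) = fps_nth ((1 - B) * ?Z) n"
      unfolding fps_mult_nth[of "1 - B"] Z f_def sum_distrib_left atLeast0AtMost
      using n by (intro sum.cong) (auto simp: of_nat_diff field_simps)
    also have "\<dots> = real n * ?\<beta> n" using ZB'[of n] by (simp add: mult.commute)
    finally have 4: "(\<Sum>k\<le>n. f n k) = ?\<beta> n" using n by simp
    show "?f n = ?\<beta> n - (\<Sum>i\<le>r. ?\<gamma> i * ?\<alpha> (n - i))"
      unfolding 2 3 4 by (simp add: right_diff_distrib)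
  qed
  finally show ?case .
qed

section \<open>Counting linear orders and cyclic permutations\<close>

lemma linear_order_on_insert_Max:
  assumes r: "linear_order_on U r" and x: "x \<notin> U"
  shows "linear_order_on (insert x U) (r \<union> insert x U \<times> {x})"
proof -
  have sub: "r \<subseteq> U \<times> U" and refl: "\<And>y. y \<in> U \<Longrightarrow> (y, y) \<in> r" and "trans r" "antisym r" "total_on U r"
    using r by (auto simp: order_on_defs refl_on_def)
  have "trans (r \<union> insert x U \<times> {x})"
    using \<open>trans r\<close> sub x unfolding trans_def by blast
  moreover have "antisym (r \<union> insert x U \<times> {x})"
    using \<open>antisym r\<close> sub x unfolding antisym_def by blast
  moreover have "total_on (insert x U) (r \<union> insert x U \<times> {x})"
    using \<open>total_on U r\<close> unfolding total_on_def by blast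
  ultimately show ?thesis
    using sub refl unfolding order_on_defs refl_on_def by blast
qed

lemma linear_order_on_Restr:
  assumes r: "linear_order_on U r" and V: "V \<subseteq> U"
  shows "linear_order_on V (Restr r V)"
proof -
  have refl: "\<And>y. y \<in> U \<Longrightarrow> (y, y) \<in> r" and *: "trans r" "antisym r" "total_on U r"
    using r by (auto simp: order_on_defs refl_on_def)
  have "trans (Restr r V)"
    using *(1) unfolding trans_def by blast
  moreover have "antisym (Restr r V)"
    using *(2) unfolding antisym_def by blast
  moreover have "total_on V (Restr r V)"
    using *(3) V unfolding total_on_def by blast
  ultimately show ?thesis
    using refl V unfolding order_on_defs refl_on_def by blast
qed

lemma linear_order_on_Max:
  assumes "finite U" "U \<noteq> {}" "linear_order_on U r"
  shows "\<exists>x\<in>U. \<forall>y\<in>U. (y, x) \<in> r"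
  using assms
proof (induction U arbitrary: r rule: finite_ne_induct)
  case (singleton x)
  then show ?case by (auto simp: order_on_defs refl_on_def)
next
  case (insert z U)
  have "linear_order_on U (Restr r U)"
    by (rule linear_order_on_Restr[OF insert.prems]) auto
  then obtain x where x: "x \<in> U" "\<And>y. y \<in> U \<Longrightarrow> (y, x) \<in> r"
    using insert.IH[of "Restr r U"] by blast
  have lin: "(z, z) \<in> r" "trans r" "(z, x) \<in> r \<or> z = x \<or> (x, z) \<in> r"
    using insert.prems x(1) by (auto simp: order_on_defs refl_on_def total_on_def)
  show ?case
  proof (cases "(z, x) \<in> r")
    case True
    then show ?thesis using x by blast
  next
    case False
    then have "(y, z) \<in> r" if "y \<in> insert z U" for y
      using that x(2) lin(1,3) transD[OF lin(2)] by blast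
    then show ?thesis by blast
  qed
qed

text \<open>A linear order is determined by its greatest element and the order on the rest: on n + 1
  elements this gives n + 1 choices times n!.\<close>

lemma card_linear_orders:
  assumes "finite U"
  shows "finite {r. linear_order_on U r} \<and> card {r. linear_order_on U r} = fact (card U)"
  using assms
proof (induction "card U" arbitrary: U)
  case 0
  then have "{r. linear_order_on U r} = {{}}"
    by (auto simp: order_on_defs refl_on_def)
  then show ?case using 0 by simp
next
  case (Suc n)
  have "bij_betw (\<lambda>(x, r). r \<union> U \<times> {x}) (SIGMA x:U. {r. linear_order_on (U - {x}) r}) {r. linear_order_on U r}"
  proof (rule bij_betw_imageI)
    show "inj_on (\<lambda>(x, r). r \<union> U \<times> {x}) (SIGMA x:U. {r. linear_order_on (U - {x}) r})"
    proof (rule inj_onI, clarify)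
      fix x r y s
      assume x: "x \<in> U" and y: "y \<in> U"
        and "linear_order_on (U - {x}) r" "linear_order_on (U - {y}) s"
        and eq: "r \<union> U \<times> {x} = s \<union> U \<times> {y}"
      then have r: "r \<subseteq> (U - {x}) \<times> (U - {x})" and s: "s \<subseteq> (U - {y}) \<times> (U - {y})"
        by (auto simp: order_on_defs refl_on_def)
      \<comment> \<open>The greatest element can be read off the union: if \<open>x\<close> and
        \<open>y\<close> differed, \<open>(y, x)\<close> would have to lie in \<open>s\<close>,
        whose field avoids \<open>y\<close>.\<close>
      have "x = y"
      proof (rule ccontr)
        assume "x \<noteq> y"
        then have "(y, x) \<in> s \<union> U \<times> {y}" using eq x y by blast
        then show False using s \<open>x \<noteq> y\<close> by blast
      qed
      then show "x = y \<and> r = s" using r s eq by blast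
    qed
    show "(\<lambda>(x, r). r \<union> U \<times> {x}) ` (SIGMA x:U. {r. linear_order_on (U - {x}) r}) = {r. linear_order_on U r}"
    proof (intro equalityI subsetI)
      fix t assume "t \<in> (\<lambda>(x, r). r \<union> U \<times> {x}) ` (SIGMA x:U. {r. linear_order_on (U - {x}) r})"
      then obtain x r where "x \<in> U" "linear_order_on (U - {x}) r" "t = r \<union> U \<times> {x}" by auto
      then show "t \<in> {r. linear_order_on U r}"
        using linear_order_on_insert_Max[of "U - {x}" r x] by (simp add: insert_absorb)
    next
      fix t assume "t \<in> {r. linear_order_on U r}"
      then have t: "linear_order_on U t" by simp
      have "finite U" "U \<noteq> {}" using Suc.hyps(2) Suc.prems by auto
      then obtain x where x: "x \<in> U" "\<And>y. y \<in> U \<Longrightarrow> (y, x) \<in> t"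
        using linear_order_on_Max[OF _ _ t] by blast
      have "linear_order_on (U - {x}) (Restr t (U - {x}))"
        by (rule linear_order_on_Restr[OF t]) auto
      moreover have "t = Restr t (U - {x}) \<union> U \<times> {x}"
      proof -
        have "t \<subseteq> U \<times> U" "antisym t" using t by (auto simp: order_on_defs)
        then show ?thesis using x unfolding antisym_def by blast
      qed
      ultimately show "t \<in> (\<lambda>(x, r). r \<union> U \<times> {x}) ` (SIGMA x:U. {r. linear_order_on (U - {x}) r})"
        using x(1) by (intro image_eqI[of _ _ "(x, Restr t (U - {x}))"]) auto
    qed
  qed
  note bij = this
  have IH: "finite {r. linear_order_on (U - {x}) r} \<and> card {r. linear_order_on (U - {x}) r} = fact n"
    if "x \<in> U" for x
    using Suc.hyps(1)[of "U - {x}"] Suc.hyps(2)[symmetric] Suc.prems that by simp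
  have "finite (SIGMA x:U. {r. linear_order_on (U - {x}) r})"
    using IH Suc.prems by blast
  moreover have "card (SIGMA x:U. {r. linear_order_on (U - {x}) r}) = fact (Suc n)"
    using IH Suc.prems Suc.hyps(2)[symmetric] by (subst card_SigmaI) auto
  ultimately show ?case
    using bij_betw_finite[OF bij] bij_betw_same_card[OF bij] Suc.hyps(2) by simp
qed

text \<open>
  The cyclic permutations of \<open>insert x U\<close> arise from those of \<open>U\<close> by inserting \<open>x\<close> behind one of
  the elements \<open>y\<close> of \<open>U\<close>.
\<close>

lemma orbit_transpose_comp:
  assumes p: "p permutes U" "cyclic_on p U" and x: "x \<notin> U" and y: "y \<in> U"
  shows "(p \<circ> Transposition.transpose x y) permutes insert x U" "cyclic_on (p \<circ> Transposition.transpose x y) (insert x U)"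
proof -
  let ?q = "p \<circ> Transposition.transpose x y"
  have px: "p x = x" using p(1) x by (simp add: permutes_not_in)
  show q: "?q permutes insert x U"
    using p(1) y by (intro permutes_compose permutes_swap_id) (auto intro: permutes_subset)
  have U: "U = orbit p y" using p(2) y by (auto simp: cyclic_on_alldef)
  have qy: "?q y = x" and qx: "?q x = p y" using px by simp_all
  \<comment> \<open>The path of \<open>?q\<close> follows that of \<open>p\<close>, except that it
    leaves \<open>y\<close> through \<open>x\<close>; the successor \<open>p y\<close> of
    \<open>y\<close> is the first point reached from \<open>x\<close>.\<close>
  have "z \<in> orbit ?q x" if "z \<in> orbit p y" for z
    using that
  proof induction
    case base
    then show ?case using orbit.base[of ?q x] unfolding qx .
  next
    case (step z)
    show ?case
    proof (cases "z = y")
      case True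
      then show ?thesis using orbit.base[of ?q x] by (simp only: qx True)
    next
      case False
      moreover have "z \<noteq> x" using step.hyps U x by auto
      ultimately have "?q z = p z" by simp
      then show ?thesis using orbit.step[OF step.IH] by simp
    qed
  qed
  then have sub: "U \<subseteq> orbit ?q x" using U by blast
  then have "x \<in> orbit ?q x" using y qy orbit.step[of y ?q x] by auto
  then have "insert x U \<subseteq> orbit ?q x" using sub by simp
  moreover have "orbit ?q x \<subseteq> insert x U" by (rule permutes_orbit_subset[OF q]) simp
  ultimately show "cyclic_on ?q (insert x U)" unfolding cyclic_on_def by blast
qed

text \<open>Composing with the same transposition undoes the insertion: \<open>y\<close> then skips
  \<open>x\<close> and goes straight to \<open>q x\<close>, while \<open>x\<close> becomes a fixed
  point.\<close>

lemma cyclic_on_remove: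
  assumes q: "q permutes insert x U" "cyclic_on q (insert x U)" and x: "x \<notin> U" and y: "y \<in> U" "q y = x"
  shows "(q \<circ> Transposition.transpose x y) permutes U" "cyclic_on (q \<circ> Transposition.transpose x y) U"
proof -
  let ?p = "q \<circ> Transposition.transpose x y"
  have px: "?p x = x" and py: "?p y = q x" using y by simp_all
  have "?p permutes insert x U"
    using q(1) y by (intro permutes_compose permutes_swap_id) auto
  then show p: "?p permutes U"
    by (rule permutes_superset) (use px in auto)
  have qxU: "insert x U = orbit q x" using q(2) by (auto simp: cyclic_on_alldef)
  \<comment> \<open>The point \<open>x\<close> is added because the orbit of \<open>q\<close> passes
    through it, whereas \<open>?p\<close> fixes it.\<close>
  have "z \<in> insert x (orbit ?p y)" if "z \<in> orbit q x" for z
    using that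
  proof induction
    case base
    then show ?case using orbit.base[of ?p y] by (simp only: py insert_iff simp_thms)
  next
    case (step z)
    show ?case
    proof (cases "z = x \<or> z = y")
      case True
      then show ?thesis using orbit.base[of ?p y] y unfolding py by (auto simp del: o_apply)
    next
      case False
      then have "?p z = q z" by simp
      moreover have "?p z \<in> orbit ?p y" using False step.IH by (blast intro: orbit.step)
      ultimately show ?thesis by (metis insertI2)
    qed
  qed
  then have "U \<subseteq> orbit ?p y" using qxU x by auto
  then have "U = orbit ?p y" using permutes_orbit_subset[OF p y(1)] by blast
  then show "cyclic_on ?p U" unfolding cyclic_on_def using y(1) by blast
qed

lemma card_cyclic_permutations:
  assumes "finite U" "U \<noteq> {}"
  shows "finite {p. p permutes U \<and> cyclic_on p U} \<and> card {p. p permutes U \<and> cyclic_on p U} = fact (card U - 1)"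
  using assms
proof (induction U rule: finite_ne_induct)
  case (singleton x)
  have "{p. p permutes {x} \<and> cyclic_on p {x}} = {id}"
  proof -
    have "cyclic_on id {x}"
      unfolding cyclic_on_def using orbit_eq_singleton_iff[of id x] by auto
    then show ?thesis by (auto simp: permutes_sing)
  qed
  then show ?case by simp
next
  case (insert x U)
  let ?C = "\<lambda>U. {p. p permutes U \<and> cyclic_on p U}"
  have tt: "q \<circ> Transposition.transpose x y \<circ> Transposition.transpose x y = q" for q :: "'a \<Rightarrow> 'a" and y
    by (simp add: fun_eq_iff)
  have "bij_betw (\<lambda>(p, y). p \<circ> Transposition.transpose x y) (?C U \<times> U) (?C (insert x U))"
  proof (rule bij_betw_imageI)
    show "inj_on (\<lambda>(p, y). p \<circ> Transposition.transpose x y) (?C U \<times> U)"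
    proof (rule inj_onI, clarify)
      fix p y p' y'
      assume *: "p permutes U" "p' permutes U" "y \<in> U" "y' \<in> U" "p \<circ> Transposition.transpose x y = p' \<circ> Transposition.transpose x y'"
      then have fixx: "p x = x" "p' x = x" using insert.hyps by (auto simp: permutes_not_in)
      \<comment> \<open>Since \<open>p\<close> fixes \<open>x\<close>, the position \<open>y\<close>
        is recovered as the element that the composite sends to \<open>x\<close>.\<close>
      have "(p' \<circ> Transposition.transpose x y') y = x"
        using fixx *(5) by (metis comp_apply transpose_apply_second)
      then have "Transposition.transpose x y' y = x"
        using fixx(2) *(2) by (metis comp_apply permutes_inj injD)
      then have "y = y'" using *(3) insert.hyps by (metis transpose_involutory transpose_apply_first)
      then show "p = p' \<and> y = y'" using *(5) tt by metis
    qed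
    show "(\<lambda>(p, y). p \<circ> Transposition.transpose x y) ` (?C U \<times> U) = ?C (insert x U)"
    proof (intro equalityI subsetI)
      fix q assume "q \<in> (\<lambda>(p, y). p \<circ> Transposition.transpose x y) ` (?C U \<times> U)"
      then show "q \<in> ?C (insert x U)" using orbit_transpose_comp insert.hyps by fast
    next
      fix q assume "q \<in> ?C (insert x U)"
      then have q: "q permutes insert x U" "cyclic_on q (insert x U)" by auto
      define y where "y = inv q x"
      have qy: "q y = x" using q(1) unfolding y_def by (simp add: permutes_inverses)
      have "y \<in> insert x U" using q(1) qy by (metis insertI1 permutes_in_image)
      moreover have "y \<noteq> x"
      proof
        assume "y = x"
        then have "orbit q x = {x}" using qy by (simp add: orbit_eq_singleton_iff)
        then show False using q(2) insert.hyps unfolding cyclic_on_alldef by auto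
      qed
      ultimately have y: "y \<in> U" by simp
      from cyclic_on_remove[OF q \<open>x \<notin> U\<close> y qy] have "(q \<circ> Transposition.transpose x y, y) \<in> ?C U \<times> U" using y by simp
      then show "q \<in> (\<lambda>(p, y). p \<circ> Transposition.transpose x y) ` (?C U \<times> U)" by (rule rev_image_eqI) (simp add: tt)
    qed
  qed
  note bij = this
  have "finite (?C U \<times> U)" using insert.IH insert.hyps by blast
  moreover have "card (?C U \<times> U) = fact (card (insert x U) - 1)"
    using insert.IH insert.hyps by (simp add: card_cartesian_product fact_reduce[of "card U"] card_gt_0_iff)
  ultimately show ?case
    using bij_betw_finite[OF bij] bij_betw_same_card[OF bij] by metis
qed

section \<open>Generating series of species\<close>

text \<open>Nonnegativity turns iterated summability into joint summability. Structure sets may be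
  infinite, so this takes the place of finite double counting.\<close>

lemma has_sum_Sigma_nonneg:
  fixes f :: "'a \<times> 'b \<Rightarrow> real"
  assumes "\<And>x. x \<in> A \<Longrightarrow> ((\<lambda>y. f (x, y)) has_sum g x) (B x)" and "(g has_sum S) A"
    and "\<And>x y. x \<in> A \<Longrightarrow> y \<in> B x \<Longrightarrow> f (x, y) \<ge> 0"
  shows "(f has_sum S) (Sigma A B)"
  using assms by (intro has_sum_SigmaI summable_on_SigmaI) (auto intro: has_sum_imp_summable)

lemma has_sum_product_nonneg:
  fixes f :: "'a \<Rightarrow> real" and g :: "'b \<Rightarrow> real"
  assumes "(f has_sum a) A" "(g has_sum b) B"
    and "\<And>x. x \<in> A \<Longrightarrow> f x \<ge> 0" "\<And>y. y \<in> B \<Longrightarrow> g y \<ge> 0"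
  shows "((\<lambda>(x, y). f x * g y) has_sum a * b) (A \<times> B)"
  using assms by (intro has_sum_Sigma_nonneg[where g = "\<lambda>x. f x * b"])
    (auto intro: has_sum_cmult_right has_sum_cmult_left)

lemma has_sum_prod_PiE_nonneg:
  fixes f :: "'a \<Rightarrow> 'b \<Rightarrow> real"
  assumes "finite A" and "\<And>x. x \<in> A \<Longrightarrow> (f x has_sum s x) (B x)"
    and "\<And>x y. x \<in> A \<Longrightarrow> y \<in> B x \<Longrightarrow> f x y \<ge> 0"
  shows "((\<lambda>g. \<Prod>x\<in>A. f x (g x)) has_sum (\<Prod>x\<in>A. s x)) (PiE A B)"
  using assms
proof (induction A rule: finite_induct)
  case empty
  then show ?case by (intro has_sum_finiteI) auto
next
  case (insert x A)
  have IH: "((\<lambda>g. \<Prod>x\<in>A. f x (g x)) has_sum (\<Prod>x\<in>A. s x)) (PiE A B)"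
    using insert by auto
  have *: "((\<lambda>(y, g). f x y * (\<Prod>z\<in>A. f z (g z))) has_sum s x * (\<Prod>x\<in>A. s x)) (B x \<times> PiE A B)"
    by (intro has_sum_product_nonneg IH insert.prems prod_nonneg) (auto intro!: insert.prems(2) prod_nonneg)
  have bij: "bij_betw (\<lambda>(y, g). g(x := y)) (B x \<times> PiE A B) (PiE (insert x A) B)"
    unfolding PiE_insert_eq bij_betw_def using inj_combinator[OF insert.hyps(2)] by simp
  have "((\<lambda>g. f x (g x) * (\<Prod>z\<in>A. f z (g z))) has_sum s x * (\<Prod>x\<in>A. s x)) (PiE (insert x A) B)"
  proof -
    have "(\<Prod>z\<in>A. f z ((g(x := y)) z)) = (\<Prod>z\<in>A. f z (g z))" for g y
      using insert.hyps by (intro prod.cong) auto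
    then show ?thesis using * bij
      by (simp add: has_sum_reindex_bij_betw[OF bij, symmetric] case_prod_unfold)
  qed
  then show ?case using insert.hyps by simp
qed

text \<open>The sum is prescribed on every finite set, not only on \<open>{1..n}\<close>, because
  products and compositions place structures on arbitrary subsets. That it depends on the
  cardinality alone stands in for invariance under transport, so the constructions below need no
  transport argument.\<close>

definition has_egf :: "('a, 's) species \<Rightarrow> real fps \<Rightarrow> bool" where
  "has_egf F X \<longleftrightarrow> (\<forall>U. finite U \<longrightarrow> (\<forall>s\<in>strs F U. wt F U s \<ge> 0) \<and>
     (wt F U has_sum fact (card U) * fps_nth X (card U)) (strs F U))"

lemma has_egf_total_weight:
  assumes "has_egf F X"
  shows "total_weight F n = fact n * fps_nth X n"
  unfolding total_weight_def by (rule infsumI) (use assms in \<open>auto simp: has_egf_def dest: spec[of _ "{1..n}"]\<close>)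

lemma weighted_speciesD:
  assumes "weighted_species F" "finite U"
  shows "wt F U summable_on strs F U"
    and "s \<in> strs F U \<Longrightarrow> wt F U s > 0"
    and "inj_on \<sigma> U \<Longrightarrow> (\<And>x. x \<in> U \<Longrightarrow> \<sigma> x = \<tau> x) \<Longrightarrow> s \<in> strs F U \<Longrightarrow> transp F U \<sigma> s = transp F U \<tau> s"
    and "inj_on \<sigma> U \<Longrightarrow> s \<in> strs F U \<Longrightarrow> transp F U \<sigma> s \<in> strs F (\<sigma> ` U)"
    and "inj_on \<sigma> U \<Longrightarrow> s \<in> strs F U \<Longrightarrow> wt F (\<sigma> ` U) (transp F U \<sigma> s) = wt F U s"
    and "s \<in> strs F U \<Longrightarrow> transp F U id s = s"
    and "inj_on \<sigma> U \<Longrightarrow> inj_on \<rho> (\<sigma> ` U) \<Longrightarrow> s \<in> strs F U \<Longrightarrow>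
      transp F U (\<rho> \<circ> \<sigma>) s = transp F (\<sigma> ` U) \<rho> (transp F U \<sigma> s)"
  using assms unfolding weighted_species_def by simp_all

lemma has_egf_weighted_species:
  fixes F :: "(nat, 's) species"
  assumes F: "weighted_species F"
  shows "has_egf F (Abs_fps (\<lambda>n. total_weight F n / fact n))"
  unfolding has_egf_def
proof (intro allI impI conjI ballI)
  fix U :: "nat set" and s assume U: "finite U"
  show "wt F U s \<ge> 0" if "s \<in> strs F U"
    using weighted_speciesD(2)[OF F U that] by simp
  define V where "V = {1..card U}"
  have V: "finite V" by (simp add: V_def)
  obtain \<sigma> where "bij_betw \<sigma> V U"
    using finite_same_card_bij[OF V U] by (auto simp: V_def)
  then have \<sigma>: "inj_on \<sigma> V" "\<sigma> ` V = U" by (auto simp: bij_betw_def)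
  define \<tau> where "\<tau> = inv_into V \<sigma>"
  have \<tau>: "inj_on \<tau> U" "\<tau> ` U = V"
    using \<sigma> by (auto simp: \<tau>_def intro: inj_on_inv_into)
  have tr: "transp F V \<sigma> t \<in> strs F U" "wt F U (transp F V \<sigma> t) = wt F V t" if "t \<in> strs F V" for t
    using weighted_speciesD(4,5)[OF F V \<sigma>(1) that] \<sigma>(2) by simp_all
  have tr': "transp F U \<tau> t \<in> strs F V" if "t \<in> strs F U" for t
    using weighted_speciesD(4)[OF F U \<tau>(1) that] \<tau>(2) by simp
  \<comment> \<open>Functoriality reduces the round trip to transport along
    \<open>g \<circ> f\<close>, which agrees with \<open>id\<close> only on \<open>W\<close>; that
    transport sees only the restriction to \<open>W\<close> does the rest.\<close>
  have comp: "transp F (f ` W) g (transp F W f t) = t"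
    if "finite W" "inj_on f W" "inj_on g (f ` W)" "\<And>x. x \<in> W \<Longrightarrow> g (f x) = x" "t \<in> strs F W" for W f g t
  proof -
    have "transp F (f ` W) g (transp F W f t) = transp F W (g \<circ> f) t"
      using weighted_speciesD(7)[OF F that(1,2,3,5)] by simp
    also have "\<dots> = transp F W id t"
      using that by (intro weighted_speciesD(3)[OF F]) (auto intro: comp_inj_on)
    also have "\<dots> = t" using weighted_speciesD(6)[OF F that(1,5)] .
    finally show ?thesis .
  qed
  have "bij_betw (transp F V \<sigma>) (strs F V) (strs F U)"
  proof (rule bij_betwI[where g = "transp F U \<tau>"])
    fix t assume "t \<in> strs F V"
    then show "transp F U \<tau> (transp F V \<sigma> t) = t"
      using comp[of V \<sigma> \<tau> t] V \<sigma> \<tau> by (auto simp: \<tau>_def)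
  next
    fix t assume "t \<in> strs F U"
    then show "transp F V \<sigma> (transp F U \<tau> t) = t"
      using comp[of U \<tau> \<sigma> t] U \<sigma> \<tau> by (auto simp: \<tau>_def f_inv_into_f)
  qed (use tr tr' in auto)
  moreover have "(wt F V has_sum total_weight F (card U)) (strs F V)"
    unfolding total_weight_def V_def[symmetric] by (intro has_sum_infsum weighted_speciesD(1)[OF F V])
  ultimately have "(wt F U has_sum total_weight F (card U)) (strs F U)"
    using has_sum_reindex_bij_betw[of "transp F V \<sigma>" "strs F V" "strs F U" "wt F U"] tr(2)
    by (simp cong: has_sum_cong)
  then show "(wt F U has_sum fact (card U) * fps_nth (Abs_fps (\<lambda>n. total_weight F n / fact n)) (card U)) (strs F U)"
    by simp
qed

lemma has_egf_empty: "has_egf empty_species 0"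
  by (simp add: has_egf_def empty_species_def)

lemma has_egf_one: "has_egf one_species 1"
  by (auto simp: has_egf_def one_species_def intro!: has_sum_finiteI)

lemma has_egf_sum:
  assumes "has_egf F X" "has_egf G Y"
  shows "has_egf (sum_species F G) (X + Y)"
  unfolding has_egf_def
proof (intro allI impI conjI ballI)
  fix U :: "'a set" and s assume U: "finite U"
  show "wt (sum_species F G) U s \<ge> 0" if "s \<in> strs (sum_species F G) U"
    using assms U that by (auto simp: has_egf_def sum_species_def)
  have "(case_sum (wt F U) (wt G U) has_sum fact (card U) * fps_nth X (card U)) (Inl ` strs F U)"
    "(case_sum (wt F U) (wt G U) has_sum fact (card U) * fps_nth Y (card U)) (Inr ` strs G U)"
    using assms U by (auto simp: has_egf_def has_sum_reindex comp_def)
  from has_sum_Un_disjoint[OF this] show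
    "(wt (sum_species F G) U has_sum fact (card U) * fps_nth (X + Y) (card U)) (strs (sum_species F G) U)"
    by (auto simp: sum_species_def Plus_def distrib_left)
qed

lemma has_egf_scale:
  assumes "has_egf F X"
  shows "has_egf (scale_species m F) (of_nat m * X)"
  unfolding has_egf_def
proof (intro allI impI conjI ballI)
  fix U :: "'a set" and s assume U: "finite U"
  show "wt (scale_species m F) U s \<ge> 0" if "s \<in> strs (scale_species m F) U"
    using assms U that by (auto simp: has_egf_def scale_species_def)
  have "((\<lambda>(i, s). 1 * wt F U s) has_sum real m * (fact (card U) * fps_nth X (card U))) ({..<m} \<times> strs F U)"
    using assms U by (intro has_sum_product_nonneg has_sum_finiteI[of "{..<m}"]) (auto simp: has_egf_def)
  then show "(wt (scale_species m F) U has_sum fact (card U) * fps_nth (of_nat m * X) (card U)) (strs (scale_species m F) U)"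
    using fps_mult_left_const_nth[of "real m" X "card U"]
    by (simp add: scale_species_def fps_of_nat mult_ac)
qed

lemma subset_convolution:
  fixes X Y :: "real fps"
  assumes "finite U"
  shows "(\<Sum>V\<in>Pow U. (fact (card V) * fps_nth X (card V)) * (fact (card (U - V)) * fps_nth Y (card (U - V))))
    = fact (card U) * fps_nth (X * Y) (card U)"
proof -
  let ?n = "card U"
  let ?h = "\<lambda>k. (fact k * fps_nth X k) * (fact (?n - k) * fps_nth Y (?n - k))"
  have "(\<Sum>V\<in>Pow U. (fact (card V) * fps_nth X (card V)) * (fact (card (U - V)) * fps_nth Y (card (U - V))))
      = (\<Sum>V\<in>Pow U. ?h (card V))"
    using assms by (intro sum.cong) (auto simp: card_Diff_subset finite_subset)
  also have "\<dots> = (\<Sum>k\<le>?n. \<Sum>V | V \<in> Pow U \<and> card V = k. ?h (card V))"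
    using assms by (intro sum.group[symmetric]) (auto intro: card_mono)
  also have "\<dots> = (\<Sum>k\<le>?n. real (?n choose k) * ?h k)"
    using assms by (intro sum.cong) (auto simp: n_subsets)
  also have "\<dots> = (\<Sum>k\<le>?n. fact ?n * (fps_nth X k * fps_nth Y (?n - k)))"
    by (intro sum.cong) (auto simp: binomial_fact)
  finally show ?thesis by (simp add: fps_mult_nth sum_distrib_left atLeast0AtMost)
qed

lemma mem_strs_prod_species:
  "((V, s), (W, t)) \<in> strs (prod_species F G) U \<longleftrightarrow>
     V \<subseteq> U \<and> W = U - V \<and> s \<in> strs F V \<and> t \<in> strs G (U - V)"
proof -
  have "V \<inter> W = {} \<and> V \<union> W = U \<longleftrightarrow> V \<subseteq> U \<and> W = U - V" by blast
  then show ?thesis unfolding prod_species_def by auto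
qed

lemma has_egf_prod:
  assumes F: "has_egf F X" and G: "has_egf G Y"
  shows "has_egf (prod_species F G) (X * Y)"
  unfolding has_egf_def
proof (intro allI impI conjI ballI)
  fix U :: "'a set" and s assume U: "finite U"
  have nnF: "wt F V s \<ge> 0" if "V \<subseteq> U" "s \<in> strs F V" for V s
    using F finite_subset[OF that(1) U] that by (auto simp: has_egf_def)
  have nnG: "wt G V s \<ge> 0" if "V \<subseteq> U" "s \<in> strs G V" for V s
    using G finite_subset[OF that(1) U] that by (auto simp: has_egf_def)
  show "wt (prod_species F G) U s \<ge> 0" if "s \<in> strs (prod_species F G) U"
    using that by (cases s) (auto simp: prod_species_def intro!: mult_nonneg_nonneg nnF nnG)
  have "((\<lambda>(V, s, t). wt F V s * wt G (U - V) t) has_sum fact (card U) * fps_nth (X * Y) (card U))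
      (SIGMA V:Pow U. strs F V \<times> strs G (U - V))"
  proof (rule has_sum_Sigma_nonneg)
    fix V assume "V \<in> Pow U"
    then have V: "finite V" "finite (U - V)" "V \<subseteq> U" using U finite_subset by auto
    have "((\<lambda>(s, t). wt F V s * wt G (U - V) t) has_sum
        (fact (card V) * fps_nth X (card V)) * (fact (card (U - V)) * fps_nth Y (card (U - V))))
        (strs F V \<times> strs G (U - V))"
      using F G V by (intro has_sum_product_nonneg) (auto simp: has_egf_def)
    then show "((\<lambda>p. case (V, p) of (V, s, t) \<Rightarrow> wt F V s * wt G (U - V) t) has_sum
        (fact (card V) * fps_nth X (card V)) * (fact (card (U - V)) * fps_nth Y (card (U - V))))
        (strs F V \<times> strs G (U - V))"
      by simp
  next
    show "((\<lambda>V. (fact (card V) * fps_nth X (card V)) * (fact (card (U - V)) * fps_nth Y (card (U - V)))) has_sum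
        fact (card U) * fps_nth (X * Y) (card U)) (Pow U)"
      using U by (intro has_sum_finiteI subset_convolution[symmetric]) auto
  qed (auto intro!: mult_nonneg_nonneg nnF nnG)
  moreover have bij: "bij_betw (\<lambda>(V, s, t). ((V, s), (U - V, t))) (SIGMA V:Pow U. strs F V \<times> strs G (U - V)) (strs (prod_species F G) U)"
  proof (rule bij_betw_imageI)
    show "inj_on (\<lambda>(V, s, t). ((V, s), (U - V, t))) (SIGMA V:Pow U. strs F V \<times> strs G (U - V))"
      by (auto simp: inj_on_def)
    show "(\<lambda>(V, s, t). ((V, s), (U - V, t))) ` (SIGMA V:Pow U. strs F V \<times> strs G (U - V)) = strs (prod_species F G) U"
    proof (intro equalityI subsetI)
      fix p assume p: "p \<in> strs (prod_species F G) U"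
      obtain V s W t where [simp]: "p = ((V, s), (W, t))" by (metis surj_pair)
      show "p \<in> (\<lambda>(V, s, t). ((V, s), (U - V, t))) ` (SIGMA V:Pow U. strs F V \<times> strs G (U - V))"
        using p by (intro image_eqI[of _ _ "(V, s, t)"]) (auto simp: mem_strs_prod_species)
    qed (auto simp: mem_strs_prod_species)
  qed
  ultimately show "(wt (prod_species F G) U has_sum fact (card U) * fps_nth (X * Y) (card U)) (strs (prod_species F G) U)"
    unfolding has_sum_reindex_bij_betw[OF bij, symmetric] by (simp add: prod_species_def case_prod_unfold)
qed

lemma has_egf_pow:
  assumes F: "has_egf F X"
  shows "has_egf (pow_species F k) (X ^ k)"
proof (induction k)
  case 0
  then show ?case by (auto simp: has_egf_def pow_species_def intro!: has_sum_finiteI)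
next
  case (Suc k)
  note P = has_egf_prod[OF F Suc]
  show ?case unfolding has_egf_def
  proof (intro allI impI conjI ballI)
    fix U :: "'a set" and s assume U: "finite U"
    \<comment> \<open>Flattening to a list forgets the set \<open>W\<close> of the second factor,
      but \<open>W\<close> is the complement of \<open>V\<close> in \<open>U\<close>.\<close>
    have bij: "bij_betw (\<lambda>((V, s), (W, t)). (V, s) # t) (strs (prod_species F (pow_species F k)) U) (strs (pow_species F (Suc k)) U)"
    proof (rule bij_betw_imageI)
      show "inj_on (\<lambda>((V, s), (W, t)). (V, s) # t) (strs (prod_species F (pow_species F k)) U)"
        by (auto simp: inj_on_def prod_species_def)
      show "(\<lambda>((V, s), (W, t)). (V, s) # t) ` strs (prod_species F (pow_species F k)) U = strs (pow_species F (Suc k)) U"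
      proof (intro equalityI subsetI)
        fix xs assume "xs \<in> strs (pow_species F (Suc k)) U"
        then obtain V W s ys where "xs = (V, s) # ys" "((V, s), (W, ys)) \<in> strs (prod_species F (pow_species F k)) U"
          by (auto simp: pow_species_def prod_species_def)
        then show "xs \<in> (\<lambda>((V, s), (W, t)). (V, s) # t) ` strs (prod_species F (pow_species F k)) U"
          by (intro image_eqI[of _ _ "((V, s), (W, ys))"]) auto
      qed (auto simp: pow_species_def prod_species_def)
    qed
    have w: "wt (pow_species F (Suc k)) U ((\<lambda>((V, s), (W, t)). (V, s) # t) p) = wt (prod_species F (pow_species F k)) U p"
      for p :: "('a set \<times> 'b) \<times> ('a set \<times> ('a set \<times> 'b) list)"
      by (auto simp: prod_species_def pow_species_def split: prod.splits)
    show "wt (pow_species F (Suc k)) U s \<ge> 0" if "s \<in> strs (pow_species F (Suc k)) U"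
      using that P U bij unfolding bij_betw_def has_egf_def using w by (metis (no_types, lifting) imageE)
    show "(wt (pow_species F (Suc k)) U has_sum fact (card U) * fps_nth (X ^ Suc k) (card U)) (strs (pow_species F (Suc k)) U)"
      using P U unfolding has_sum_reindex_bij_betw[OF bij, symmetric] w has_egf_def by simp
  qed
qed

text \<open>
  The induction counts the partitions into \<open>m + 1\<close> blocks with one block marked in two ways.
\<close>

lemma set_partition_power:
  fixes X :: "real fps"
  assumes "finite U" and X0: "fps_nth X 0 = 0"
  shows "fact m * (\<Sum>\<pi> | partition_on U \<pi> \<and> card \<pi> = m. \<Prod>V\<in>\<pi>. fact (card V) * fps_nth X (card V))
    = fact (card U) * fps_nth (X ^ m) (card U)"
  using assms(1)
proof (induction m arbitrary: U)
  case 0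
  have "{\<pi>. partition_on U \<pi> \<and> card \<pi> = 0} = (if U = {} then {{}} else {})"
    using finite_elements[OF 0] by (auto simp: partition_on_def)
  then show ?case using 0 by auto
next
  case (Suc m)
  define b where "b = (\<lambda>V :: 'a set. fact (card V) * fps_nth X (card V))"
  let ?P = "\<lambda>m U. {\<pi>. partition_on U \<pi> \<and> card \<pi> = m}"
  have fin: "finite (?P m U)" if "finite U" for m and U :: "'a set"
    using finitely_many_partition_on[OF that] by (rule rev_finite_subset) auto
  have remove: "partition_on (U - V) (\<pi> - {V}) \<and> card (\<pi> - {V}) = m \<and> V \<subseteq> U \<and> V \<noteq> {} \<and> insert V (\<pi> - {V}) = \<pi>"
    if \<pi>: "partition_on U \<pi>" "card \<pi> = Suc m" "V \<in> \<pi>" for \<pi> V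
  proof -
    have "disjnt V (\<Union>(\<pi> - {V}))"
      using \<pi> by (auto simp: partition_on_def disjoint_def disjnt_iff)
    from partition_on_insert[OF this, of U] \<pi> show ?thesis
      by (simp add: insert_absorb)
  qed
  have insert: "partition_on U (insert V \<pi>) \<and> card (insert V \<pi>) = Suc m \<and> insert V \<pi> - {V} = \<pi>"
    if \<pi>: "V \<subseteq> U" "V \<noteq> {}" "partition_on (U - V) \<pi>" "card \<pi> = m" for V \<pi>
  proof -
    have disj: "disjnt V (\<Union>\<pi>)" using \<pi> by (auto simp: partition_on_def disjnt_iff)
    then have "V \<notin> \<pi>" using \<pi>(2) by (auto simp: disjnt_iff)
    moreover have "partition_on U (insert V \<pi>)" using partition_on_insert[OF disj, of U] \<pi> by simp
    moreover have "finite \<pi>" using finite_elements[OF _ \<pi>(3)] Suc.prems by simp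
    ultimately show ?thesis using \<pi>(4) by simp
  qed
  have bij: "(\<Sum>(\<pi>, V)\<in>(SIGMA \<pi>:?P (Suc m) U. \<pi>). b V * (\<Prod>W\<in>\<pi> - {V}. b W))
      = (\<Sum>(V, \<pi>)\<in>(SIGMA V:Pow U - {{}}. ?P m (U - V)). b V * (\<Prod>W\<in>\<pi>. b W))"
  proof (rule sum.reindex_bij_witness[where j = "\<lambda>(\<pi>, V). (V, \<pi> - {V})" and i = "\<lambda>(V, \<pi>). (insert V \<pi>, V)"], goal_cases)
    case (1 p)
    then show ?case using remove[of "fst p" "snd p"] by (cases p) auto
  next
    case (2 p)
    then show ?case using remove[of "fst p" "snd p"] by (cases p) auto
  next
    case (3 q)
    then show ?case using insert[of "fst q" "snd q"] by (cases q) auto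
  next
    case (4 q)
    then show ?case using insert[of "fst q" "snd q"] by (cases q) auto
  next
    case (5 p)
    then show ?case by (cases p) auto
  qed
  have "real (Suc m) * (\<Sum>\<pi>\<in>?P (Suc m) U. \<Prod>V\<in>\<pi>. b V) = (\<Sum>\<pi>\<in>?P (Suc m) U. \<Sum>V\<in>\<pi>. b V * (\<Prod>W\<in>\<pi> - {V}. b W))"
    unfolding sum_distrib_left
  proof (intro sum.cong refl)
    fix \<pi> assume "\<pi> \<in> ?P (Suc m) U"
    then have \<pi>: "finite \<pi>" "card \<pi> = Suc m" using finite_elements[OF Suc.prems] by auto
    then have "(\<Sum>V\<in>\<pi>. b V * (\<Prod>W\<in>\<pi> - {V}. b W)) = (\<Sum>V\<in>\<pi>. \<Prod>W\<in>\<pi>. b W)"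
      by (intro sum.cong refl prod.remove[symmetric])
    then show "real (Suc m) * (\<Prod>V\<in>\<pi>. b V) = (\<Sum>V\<in>\<pi>. b V * (\<Prod>W\<in>\<pi> - {V}. b W))"
      using \<pi> by simp
  qed
  also have "\<dots> = (\<Sum>(\<pi>, V)\<in>(SIGMA \<pi>:?P (Suc m) U. \<pi>). b V * (\<Prod>W\<in>\<pi> - {V}. b W))"
    using fin[OF Suc.prems] finite_elements[OF Suc.prems] by (subst sum.Sigma) auto
  also note bij
  also have "(\<Sum>(V, \<pi>)\<in>(SIGMA V:Pow U - {{}}. ?P m (U - V)). b V * (\<Prod>W\<in>\<pi>. b W))
      = (\<Sum>V\<in>Pow U - {{}}. b V * (\<Sum>\<pi>\<in>?P m (U - V). \<Prod>W\<in>\<pi>. b W))"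
    using Suc.prems fin by (subst sum.Sigma[symmetric]) (auto simp: sum_distrib_left)
  \<comment> \<open>The empty set may be added as a marked block because \<open>b {}\<close> is the
    constant term of \<open>X\<close>, hence 0; the sum then has the form of
    \<open>subset_convolution\<close>.\<close>
  also have "\<dots> = (\<Sum>V\<in>Pow U. b V * (\<Sum>\<pi>\<in>?P m (U - V). \<Prod>W\<in>\<pi>. b W))"
    using Suc.prems by (intro sum.mono_neutral_left) (auto simp: b_def X0)
  finally have rec: "real (Suc m) * (\<Sum>\<pi>\<in>?P (Suc m) U. \<Prod>V\<in>\<pi>. b V)
      = (\<Sum>V\<in>Pow U. b V * (\<Sum>\<pi>\<in>?P m (U - V). \<Prod>W\<in>\<pi>. b W))" .
  have "fact (Suc m) * (\<Sum>\<pi>\<in>?P (Suc m) U. \<Prod>V\<in>\<pi>. b V)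
      = fact m * (real (Suc m) * (\<Sum>\<pi>\<in>?P (Suc m) U. \<Prod>V\<in>\<pi>. b V))"
    by (simp only: fact_Suc mult_ac)
  also have "\<dots> = (\<Sum>V\<in>Pow U. b V * (fact m * (\<Sum>\<pi>\<in>?P m (U - V). \<Prod>W\<in>\<pi>. b W)))"
    unfolding rec by (simp add: sum_distrib_left mult_ac)
  also have "\<dots> = (\<Sum>V\<in>Pow U. b V * (fact (card (U - V)) * fps_nth (X ^ m) (card (U - V))))"
    using Suc unfolding b_def by (intro sum.cong) auto
  also have "\<dots> = fact (card U) * fps_nth (X ^ Suc m) (card U)"
    unfolding b_def using subset_convolution[OF Suc.prems, of X "X ^ m"] by simp
  finally show ?case unfolding b_def .
qed

text \<open>Bounds the number of blocks, so that a composition splits into finitely many restricted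
  ones.\<close>

lemma card_partition_le:
  assumes "finite U" "partition_on U \<pi>"
  shows "card \<pi> \<le> card U"
proof -
  have fin: "finite V" "card V \<ge> 1" if "V \<in> \<pi>" for V
  proof -
    show "finite V" using that assms by (auto simp: partition_on_def intro: finite_subset)
    then show "card V \<ge> 1" using that assms(2) by (cases "V = {}") (auto simp: partition_on_def Suc_le_eq card_gt_0_iff)
  qed
  have "card \<pi> = (\<Sum>V\<in>\<pi>. 1)" by simp
  also have "\<dots> \<le> (\<Sum>V\<in>\<pi>. card V)" by (rule sum_mono) (use fin in auto)
  also have "\<dots> = card U"
    using assms(2) fin by (subst card_Union_disjoint[symmetric]) (auto simp: partition_on_def disjnt_def pairwise_def disjoint_def)
  finally show ?thesis .
qed

text \<open>The number of structures on the blocks is the same for all partitions into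
  \<open>m\<close> blocks, so it factors out and \<open>set_partition_power\<close> supplies 1 / m!.
  Linear orders and cyclic permutations differ only in the value of \<open>c\<close>.\<close>

lemma has_egf_comp_restr:
  fixes F :: "('a set, 'f) species" and B :: "('a, 'b) species"
  assumes B: "has_egf B X" and B0: "strs B {} = {}"
    and F: "\<And>\<pi>. finite \<pi> \<Longrightarrow> card \<pi> = m \<Longrightarrow> finite (strs F \<pi>) \<and> card (strs F \<pi>) = c"
    and wF: "\<And>\<pi> f. wt F \<pi> f = 1"
  shows "has_egf (comp_species (restr_species m F) B) (fps_const (real c / fact m) * X ^ m)"
  unfolding has_egf_def
proof (intro allI impI conjI ballI)
  fix U :: "'a set" and s assume U: "finite U"
  let ?P = "{\<pi>. partition_on U \<pi> \<and> card \<pi> = m}"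
  let ?b = "\<lambda>V. fact (card V) * fps_nth X (card V)"
  let ?w = "\<lambda>\<pi> \<beta>. \<Prod>V\<in>\<pi>. wt B V (\<beta> V)"
  have finV: "finite V" if "V \<in> \<pi>" "partition_on U \<pi>" for V \<pi>
    using that U by (auto simp: partition_on_def intro: finite_subset)
  have nn: "wt B V t \<ge> 0" if "V \<in> \<pi>" "partition_on U \<pi>" "t \<in> strs B V" for V \<pi> t
    using B finV[OF that(1,2)] that(3) by (auto simp: has_egf_def)
  \<comment> \<open>A sum over no structures is 0, which gives the zero constant term that
    \<open>set_partition_power\<close> requires.\<close>
  have "(wt B {} has_sum fps_nth X 0) {}"
    using B B0 unfolding has_egf_def by (metis card.empty fact_0 finite.emptyI mult_1)
  then have X0: "fps_nth X 0 = 0" by (simp add: has_sum_iff)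
  have strs: "strs (comp_species (restr_species m F) B) U = (SIGMA \<pi>:?P. strs F \<pi> \<times> (\<Pi>\<^sub>E V\<in>\<pi>. strs B V))"
    using finite_elements[OF U] by (auto simp: comp_species_def restr_species_def split: if_splits)
  \<comment> \<open>The factor 1 is the weight of \<open>f\<close>, kept to match the product form
    of \<open>has_sum_product_nonneg\<close>.\<close>
  have wts: "wt (comp_species (restr_species m F) B) U = (\<lambda>(\<pi>, f, \<beta>). 1 * ?w \<pi> \<beta>)"
    by (auto simp: comp_species_def restr_species_def wF)
  show "wt (comp_species (restr_species m F) B) U s \<ge> 0" if "s \<in> strs (comp_species (restr_species m F) B) U"
    using that unfolding strs wts by (auto intro!: prod_nonneg nn)
  have "((\<lambda>(\<pi>, f, \<beta>). 1 * ?w \<pi> \<beta>) has_sum fact (card U) * fps_nth (fps_const (real c / fact m) * X ^ m) (card U))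
      (SIGMA \<pi>:?P. strs F \<pi> \<times> (\<Pi>\<^sub>E V\<in>\<pi>. strs B V))"
  proof (rule has_sum_Sigma_nonneg)
    fix \<pi> assume "\<pi> \<in> ?P"
    then have \<pi>: "partition_on U \<pi>" "card \<pi> = m" "finite \<pi>" using finite_elements[OF U] by auto
    have "((\<lambda>(f, \<beta>). 1 * ?w \<pi> \<beta>) has_sum real c * (\<Prod>V\<in>\<pi>. ?b V)) (strs F \<pi> \<times> (\<Pi>\<^sub>E V\<in>\<pi>. strs B V))"
    proof (rule has_sum_product_nonneg)
      show "((\<lambda>f. 1) has_sum real c) (strs F \<pi>)" using F[OF \<pi>(3,2)] by (intro has_sum_finiteI) auto
      show "(?w \<pi> has_sum (\<Prod>V\<in>\<pi>. ?b V)) (\<Pi>\<^sub>E V\<in>\<pi>. strs B V)"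
        using \<pi> B finV nn by (intro has_sum_prod_PiE_nonneg) (auto simp: has_egf_def)
    qed (auto intro!: prod_nonneg nn \<pi>(1))
    then show "((\<lambda>y. case (\<pi>, y) of (\<pi>, f, \<beta>) \<Rightarrow> 1 * ?w \<pi> \<beta>) has_sum real c * (\<Prod>V\<in>\<pi>. ?b V))
        (strs F \<pi> \<times> (\<Pi>\<^sub>E V\<in>\<pi>. strs B V))" by simp
  next
    have "finite ?P" using finitely_many_partition_on[OF U] by (rule rev_finite_subset) auto
    moreover have "fact (card U) * fps_nth (fps_const (real c / fact m) * X ^ m) (card U) = (\<Sum>\<pi>\<in>?P. real c * (\<Prod>V\<in>\<pi>. ?b V))"
      using set_partition_power[OF U X0, of m] by (simp add: sum_distrib_left[symmetric] field_simps)
    ultimately show "((\<lambda>\<pi>. real c * (\<Prod>V\<in>\<pi>. ?b V)) has_sum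
        fact (card U) * fps_nth (fps_const (real c / fact m) * X ^ m) (card U)) ?P"
      by (rule has_sum_finiteI)
  qed (auto intro!: prod_nonneg nn)
  then show "(wt (comp_species (restr_species m F) B) U has_sum
      fact (card U) * fps_nth (fps_const (real c / fact m) * X ^ m) (card U)) (strs (comp_species (restr_species m F) B) U)"
    unfolding strs wts .
qed

text \<open>Structures are sorted by their number of blocks, which is at most \<open>card U\<close>;
  this is also where the sum defining a coefficient of \<open>oo\<close> stops.\<close>

lemma has_egf_comp:
  fixes F :: "('a set, 'f) species" and B :: "('a, 'b) species"
  assumes B: "has_egf B X" and B0: "strs B {} = {}"
    and F: "\<And>\<pi>. finite \<pi> \<Longrightarrow> finite (strs F \<pi>) \<and> card (strs F \<pi>) = c (card \<pi>)"
    and wF: "\<And>\<pi> f. wt F \<pi> f = 1"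
  shows "has_egf (comp_species F B) (Abs_fps (\<lambda>m. real (c m) / fact m) oo X)"
  unfolding has_egf_def
proof (intro allI impI conjI ballI)
  fix U :: "'a set" and s assume U: "finite U"
  let ?R = "\<lambda>m. comp_species (restr_species m F) B"
  have R: "has_egf (?R m) (fps_const (real (c m) / fact m) * X ^ m)" for m
    using F wF by (intro has_egf_comp_restr B B0) auto
  have strs: "strs (comp_species F B) U = (\<Union>m\<le>card U. strs (?R m) U)"
    using card_partition_le[OF U] finite_elements[OF U] by (auto simp: comp_species_def restr_species_def split: if_splits)
  have wts: "wt (?R m) = wt (comp_species F B)" for m
    by (simp add: comp_species_def restr_species_def)
  show "wt (comp_species F B) U s \<ge> 0" if "s \<in> strs (comp_species F B) U"
    using that R U unfolding strs has_egf_def wts by blast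
  have "(wt (comp_species F B) U has_sum (\<Sum>m\<le>card U. fact (card U) * fps_nth (fps_const (real (c m) / fact m) * X ^ m) (card U)))
      (\<Union>m\<le>card U. strs (?R m) U)"
  proof (rule sum_has_sum)
    show "strs (?R m) U \<inter> strs (?R m') U = {}" if "m \<noteq> m'" for m m'
      using that by (auto simp: comp_species_def restr_species_def split: if_splits)
  qed (use R U wts in \<open>auto simp: has_egf_def\<close>)
  then show "(wt (comp_species F B) U has_sum fact (card U) * fps_nth (Abs_fps (\<lambda>m. real (c m) / fact m) oo X) (card U))
      (strs (comp_species F B) U)"
    unfolding strs by (simp add: fps_compose_nth atLeast0AtMost sum_distrib_left)
qed

lemma has_egf_iso:
  assumes G: "has_egf G X" and iso: "species_iso \<phi> F G"
  shows "has_egf F X"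
  unfolding has_egf_def
proof (intro allI impI conjI ballI)
  fix U :: "'a set" and s assume U: "finite U"
  have bij: "bij_betw (\<phi> U) (strs F U) (strs G U)" and w: "\<And>s. s \<in> strs F U \<Longrightarrow> wt G U (\<phi> U s) = wt F U s"
    using iso U by (auto simp: species_iso_def)
  show "wt F U s \<ge> 0" if "s \<in> strs F U"
    using w[OF that, symmetric] bij_betwE[OF bij] that G U by (simp add: has_egf_def)
  have "((\<lambda>s. wt G U (\<phi> U s)) has_sum fact (card U) * fps_nth X (card U)) (strs F U)"
    using G U unfolding has_sum_reindex_bij_betw[OF bij] by (simp add: has_egf_def)
  then show "(wt F U has_sum fact (card U) * fps_nth X (card U)) (strs F U)"
    using w by (simp cong: has_sum_cong)
qed

text \<open>\<open>embed_pmf\<close> has the intended point probabilities once the normalized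
  weights are known to be nonnegative with total mass 1. Nonnegativity and the nonzero coefficient
  together make the total weight positive.\<close>

lemma prob_random_structure:
  assumes A: "has_egf A X" and pos: "fps_nth X n \<noteq> 0" and S: "S \<subseteq> strs A {1..n}"
    and Y: "(wt A {1..n} has_sum y) S"
  shows "measure_pmf.prob (random_structure A n) S = y / total_weight A n"
proof -
  let ?a = "total_weight A n"
  let ?f = "\<lambda>s. if s \<in> strs A {1..n} then wt A {1..n} s / ?a else 0"
  have a: "?a = fact n * fps_nth X n" by (rule has_egf_total_weight[OF A])
  have nn: "wt A {1..n} s \<ge> 0" if "s \<in> strs A {1..n}" for s
    using A that by (auto simp: has_egf_def)
  have sum: "(wt A {1..n} has_sum ?a) (strs A {1..n})"
    using A by (auto simp: has_egf_def a dest: spec[of _ "{1..n}"])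
  have "?a \<ge> 0" by (rule has_sum_nonneg[OF sum nn])
  moreover have "?a \<noteq> 0" using pos by (simp add: a)
  ultimately have a_pos: "?a > 0" by linarith
  have f_nn: "?f s \<ge> 0" for s using nn a_pos by simp
  have f_sum: "(?f has_sum (z / ?a)) T" if "T \<subseteq> strs A {1..n}" "(wt A {1..n} has_sum z) T" for T z
  proof -
    have "((\<lambda>s. wt A {1..n} s * (1 / ?a)) has_sum z * (1 / ?a)) T"
      using that(2) by (rule has_sum_cmult_left)
    also have "?this \<longleftrightarrow> (?f has_sum (z / ?a)) T"
      using that(1) by (simp, intro has_sum_cong) auto
    finally show ?thesis .
  qed
  have "(?f has_sum 1) (strs A {1..n})" using f_sum[OF _ sum] a_pos by simp
  then have one: "(?f has_sum 1) UNIV"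
    by (rule has_sum_cong_neutral[THEN iffD1, rotated -1]) auto
  have f_abs: "Infinite_Set_Sum.abs_summable_on ?f T" for T
    by (rule abs_summable_equivalent[THEN iffD1], rule summable_on_iff_abs_summable_on_real[THEN iffD1],
        rule summable_on_subset_banach[OF has_sum_imp_summable[OF one]]) simp
  have "(\<integral>\<^sup>+s. ennreal (?f s) \<partial>count_space UNIV) = ennreal (infsetsum ?f UNIV)"
    using f_abs f_nn by (intro nn_integral_conv_infsetsum)
  also have "infsetsum ?f UNIV = 1"
    using infsetsum_infsum[OF f_abs, of UNIV] infsumI[OF one] by simp
  finally have int: "(\<integral>\<^sup>+s. ennreal (?f s) \<partial>count_space UNIV) = 1" by simp
  have pmf: "pmf (random_structure A n) s = ?f s" for s
    unfolding random_structure_def by (rule pmf_embed_pmf[OF f_nn int])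
  have "measure_pmf.prob (random_structure A n) S = infsetsum ?f S"
    unfolding measure_pmf_conv_infsetsum pmf ..
  also have "\<dots> = infsum ?f S"
    using f_abs by (rule infsetsum_infsum)
  also have "\<dots> = y / ?a" by (rule infsumI[OF f_sum[OF S Y]])
  finally show ?thesis .
qed

section \<open>Coefficient bounds and functional equations for composed series\<close>

lemma fps_power_nonneg:
  fixes X :: "real fps"
  assumes "\<And>n. fps_nth X n \<ge> 0"
  shows "fps_nth (X ^ m) n \<ge> 0"
proof (induction m arbitrary: n)
  case (Suc m)
  then show ?case using assms by (auto simp: fps_mult_nth intro!: sum_nonneg)
qed simp

text \<open>The source of domination: with C composed with X as the series of A, every power of X
  whose coefficient in C is positive is bounded by a multiple of it.\<close>

lemma fps_compose_term_le:
  fixes X C :: "real fps"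
  assumes X: "\<And>n. fps_nth X n \<ge> 0" and X0: "fps_nth X 0 = 0" and C: "\<And>m. fps_nth C m \<ge> 0"
  shows "fps_nth C m * fps_nth (X ^ m) n \<le> fps_nth (C oo X) n"
proof (cases "m \<le> n")
  case True
  then show ?thesis unfolding fps_compose_nth
    by (intro member_le_sum[of m "{0..n}" "\<lambda>m. fps_nth C m * fps_nth (X ^ m) n"]) (auto intro: C fps_power_nonneg X mult_nonneg_nonneg)
next
  case False
  then have "fps_nth (X ^ m) n = 0" using startsby_zero_power_prefix[OF X0] by auto
  then show ?thesis by (auto simp: fps_compose_nth intro!: sum_nonneg mult_nonneg_nonneg C fps_power_nonneg X)
qed

lemma fps_geometric_compose:
  fixes X :: "real fps"
  assumes "fps_nth X 0 = 0"
  shows "(Abs_fps (\<lambda>_. 1) oo X) * (1 - X) = 1"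
proof -
  have "Abs_fps (\<lambda>_. 1 :: real) * (1 - fps_X) = 1"
    by (rule fps_ext) (simp add: right_diff_distrib)
  then have "(Abs_fps (\<lambda>_. 1) * (1 - fps_X)) oo X = (1 :: real fps)" by simp
  then show ?thesis
    unfolding fps_compose_mult_distrib[OF assms]
    by (simp add: fps_compose_sub_distrib fps_X_fps_compose_startby0[OF assms])
qed

text \<open>The outer series has coefficients 1 / m and is -log (1 - z), whose derivative is the
  geometric series.\<close>

lemma fps_log_compose_deriv:
  fixes X :: "real fps"
  assumes "fps_nth X 0 = 0"
  shows "fps_deriv (Abs_fps (\<lambda>m. (if m = 0 then 0 else fact (m - 1)) / fact m) oo X) * (1 - X) = fps_deriv X"
proof -
  have "fps_deriv (Abs_fps (\<lambda>m. (if m = 0 then 0 else fact (m - 1)) / fact m)) = Abs_fps (\<lambda>_. 1 :: real)"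
    by (rule fps_ext) (simp add: field_simps del: of_nat_Suc)
  then show ?thesis
    using fps_geometric_compose[OF assms] by (simp add: fps_compose_deriv[OF assms] mult_ac)
qed

section \<open>Generating series of virtual species\<close>

text \<open>The two parts keep separate series because \<open>has_egf\<close> requires nonnegative
  weights, while a difference may have negative coefficients.\<close>

definition has_vegf :: "('a, 'p, 'n) virtual_species \<Rightarrow> real fps \<Rightarrow> bool" where
  "has_vegf = (\<lambda>(P, N) X. \<exists>Y Z. has_egf P Y \<and> has_egf N Z \<and> X = Y - Z)"

lemma has_vegf_of_species: "has_egf F X \<Longrightarrow> has_vegf (of_species F) X"
  using has_egf_empty unfolding has_vegf_def of_species_def prod.case by (metis diff_zero)

lemma has_vegf_one_minus: "has_egf F X \<Longrightarrow> has_vegf (one_minus F) (1 - X)"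
  using has_egf_one unfolding has_vegf_def one_minus_def prod.case by metis

lemma has_vegf_vprod:
  assumes "has_vegf V X" "has_vegf W Y"
  shows "has_vegf (vprod V W) (X * Y)"
proof -
  obtain P N P' N' where [simp]: "V = (P, N)" "W = (P', N')" by (metis surj_pair)
  obtain p n p' n' where *: "has_egf P p" "has_egf N n" "X = p - n" "has_egf P' p'" "has_egf N' n'" "Y = p' - n'"
    using assms unfolding has_vegf_def by auto
  have "has_egf (sum_species (prod_species P P') (prod_species N N')) (p * p' + n * n')"
    "has_egf (sum_species (prod_species P N') (prod_species N P')) (p * n' + n * p')"
    using * by (auto intro!: has_egf_sum has_egf_prod)
  moreover have "X * Y = (p * p' + n * n') - (p * n' + n * p')"
    unfolding * by (simp add: algebra_simps)
  ultimately show ?thesis unfolding has_vegf_def vprod_def by auto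
qed

lemma has_vegf_vscale:
  assumes "has_vegf V X"
  shows "has_vegf (vscale m V) (of_nat m * X)"
proof -
  obtain P N where [simp]: "V = (P, N)" by (metis surj_pair)
  obtain p n where *: "has_egf P p" "has_egf N n" "X = p - n"
    using assms unfolding has_vegf_def by auto
  then have "has_egf (scale_species m P) (of_nat m * p)" "has_egf (scale_species m N) (of_nat m * n)"
    by (auto intro!: has_egf_scale)
  moreover have "of_nat m * X = of_nat m * p - of_nat m * n" using * by (simp add: right_diff_distrib)
  ultimately show ?thesis unfolding has_vegf_def vscale_def by auto
qed

lemma has_vegf_vtotal_weight:
  "has_vegf V X \<Longrightarrow> vtotal_weight V n = fact n * fps_nth X n"
  unfolding has_vegf_def vtotal_weight_def
  by (auto simp: has_egf_total_weight right_diff_distrib split: prod.splits)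

lemma d_lin_eq:
  assumes "has_egf B X"
  shows "d_lin B k m = fact k * fps_nth (of_nat m * X ^ (m - 1) * (1 - X)\<^sup>2) k"
  unfolding d_lin_def power2_eq_square mult.assoc
  by (intro has_vegf_vtotal_weight has_vegf_vscale has_vegf_vprod has_vegf_of_species has_vegf_one_minus has_egf_pow assms)

lemma d_cyc_eq:
  assumes "has_egf B X"
  shows "d_cyc B k m = (if m = 0 then 0 else fact k * fps_nth (X ^ (m - 1) * (1 - X)) k)"
proof -
  have "vtotal_weight (vprod (of_species (pow_species B (m - 1))) (one_minus B)) k = fact k * fps_nth (X ^ (m - 1) * (1 - X)) k"
    by (intro has_vegf_vtotal_weight has_vegf_vprod has_vegf_of_species has_vegf_one_minus has_egf_pow assms)
  then show ?thesis
    by (cases "m = 0") (simp_all add: d_cyc_def vtotal_weight_def has_egf_total_weight[OF has_egf_empty])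
qed

lemma has_egf_nonneg:
  fixes F :: "(nat, 's) species"
  assumes "has_egf F X"
  shows "fps_nth X n \<ge> 0"
proof -
  have "fact n * fps_nth X n \<ge> 0"
  proof (rule has_sum_nonneg)
    show "(wt F {1..n} has_sum fact n * fps_nth X n) (strs F {1..n})"
      using assms by (auto simp: has_egf_def dest: spec[of _ "{1..n}"])
  qed (use assms in \<open>auto simp: has_egf_def\<close>)
  then show ?thesis using fact_gt_zero[of n, where 'a = real] by (auto simp: zero_le_mult_iff)
qed

section \<open>From coefficients to probabilities\<close>

text \<open>For n >= k the k-th scale function is the coefficient ratio at n - k and n divided by
  k!, and the k! in \<open>d k\<close> cancels this. Dividing by the n-th coefficient makes sense
  for large n only, so \<open>p\<close> is prescribed just where that coefficient is
  nonzero.\<close>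

lemma asymp_expansion_ratio:
  assumes A: "has_egf A X" and garg: "gargantuan (fps_nth X)"
    and p: "\<And>n. fps_nth X n \<noteq> 0 \<Longrightarrow> p n = fact n * fps_nth Y n / total_weight A n"
    and exp: "\<And>r. expansion (fps_nth X) r (fps_nth Y) (fps_nth D)"
    and d: "\<And>k. d k = fact k * fps_nth D k"
  shows "asymp_expansion p d (\<lambda>k n. real (n choose k) * (total_weight A (n - k) / total_weight A n))"
proof -
  let ?\<alpha> = "fps_nth X"
  let ?g = "\<lambda>k n. real (n choose k) * (total_weight A (n - k) / total_weight A n)"
  have g: "?g k n = ?\<alpha> (n - k) / fact k / ?\<alpha> n" if "k \<le> n" for k n
    using that by (simp add: has_egf_total_weight[OF A] binomial_fact field_simps)
  have nz: "\<forall>\<^sub>F n in sequentially. ?\<alpha> n \<noteq> 0" using garg by (simp add: gargantuan_def)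
  have g_ev: "\<forall>\<^sub>F n in sequentially. ?g k n = ?\<alpha> (n - k) / fact k / ?\<alpha> n" for k
    using eventually_ge_at_top[of k] by eventually_elim (rule g)
  have g_theta: "?g k \<in> \<Theta>(\<lambda>n. ?\<alpha> (n - k) / ?\<alpha> n)" for k
  proof -
    have "(\<lambda>n. 1 / fact k * (?\<alpha> (n - k) / ?\<alpha> n)) \<in> \<Theta>(\<lambda>n. ?\<alpha> (n - k) / ?\<alpha> n)"
      by (subst landau_theta.cmult_in_iff) simp_all
    then have "(\<lambda>n. ?\<alpha> (n - k) / fact k / ?\<alpha> n) \<in> \<Theta>(\<lambda>n. ?\<alpha> (n - k) / ?\<alpha> n)"
      by (simp add: mult.commute)
    then show ?thesis using landau_theta.in_cong[OF g_ev] by blast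
  qed
  show ?thesis unfolding asymp_expansion_def
  proof (intro conjI allI)
    fix k
    have "(\<lambda>n. ?\<alpha> (n - Suc k) / ?\<alpha> n) \<in> o(\<lambda>n. ?\<alpha> (n - k) / ?\<alpha> n)"
      by (intro landau_o.small.divide_right[OF nz] gargantuan_smallo_Suc[OF garg])
    then show "?g (Suc k) \<in> o(?g k)"
      unfolding landau_o.small.in_cong_bigtheta[OF g_theta] landau_o.small.cong_bigtheta[OF g_theta] .
  next
    fix r
    have "\<forall>\<^sub>F n in sequentially. p n - (\<Sum>k\<le>r. d k * ?g k n) = (fps_nth Y n - (\<Sum>i\<le>r. fps_nth D i * ?\<alpha> (n - i))) / ?\<alpha> n"
      using nz eventually_ge_at_top[of r]
    proof eventually_elim
      case (elim n)
      have "p n = fps_nth Y n / ?\<alpha> n" using p[OF elim(1)] by (simp add: has_egf_total_weight[OF A])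
      moreover have "(\<Sum>k\<le>r. d k * ?g k n) = (\<Sum>i\<le>r. fps_nth D i * ?\<alpha> (n - i)) / ?\<alpha> n"
        unfolding sum_divide_distrib using elim by (intro sum.cong refl) (simp add: g d del: times_divide_eq_right, simp)
      ultimately show ?case by (simp add: diff_divide_distrib)
    qed
    moreover have "(\<lambda>n. (fps_nth Y n - (\<Sum>i\<le>r. fps_nth D i * ?\<alpha> (n - i))) / ?\<alpha> n) \<in> O(\<lambda>n. ?\<alpha> (n - Suc r) / ?\<alpha> n)"
      using exp[of r] unfolding expansion_def by (intro landau_o.big.divide_right[OF nz])
    ultimately have "(\<lambda>n. p n - (\<Sum>k\<le>r. d k * ?g k n)) \<in> O(\<lambda>n. ?\<alpha> (n - Suc r) / ?\<alpha> n)"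
      by (subst landau_o.big.in_cong)
    then show "(\<lambda>n. p n - (\<Sum>k\<le>r. d k * ?g k n)) \<in> O(?g (Suc r))"
      unfolding landau_o.big.cong_bigtheta[OF g_theta] .
  qed
qed

text \<open>The isomorphism restricts to a weight-preserving bijection from the event onto the
  structures with \<open>m\<close> blocks, so the series of the latter evaluates the event.\<close>

lemma prob_comp_restr:
  fixes A :: "(nat, 's) species" and B :: "(nat, 't) species" and F :: "(nat set, 'f) species"
  assumes iso: "species_iso \<phi> A (comp_species F B)"
    and A: "has_egf A X" and nz: "fps_nth X n \<noteq> 0"
    and R: "has_egf (comp_species (restr_species m F) B) Y"
  shows "measure_pmf.prob (random_structure A n)
      {s \<in> strs A {1..n}. \<phi> {1..n} s \<in> strs (comp_species (restr_species m F) B) {1..n}}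
    = fact n * fps_nth Y n / total_weight A n"
proof (rule prob_random_structure[OF A nz])
  let ?U = "{1..n}" and ?R = "comp_species (restr_species m F) B"
  let ?S = "{s \<in> strs A ?U. \<phi> ?U s \<in> strs ?R ?U}"
  have bij: "bij_betw (\<phi> ?U) (strs A ?U) (strs (comp_species F B) ?U)"
    and w: "\<And>s. s \<in> strs A ?U \<Longrightarrow> wt (comp_species F B) ?U (\<phi> ?U s) = wt A ?U s"
    using iso by (auto simp: species_iso_def)
  have "strs ?R ?U \<subseteq> strs (comp_species F B) ?U"
    by (auto simp: comp_species_def restr_species_def split: if_splits)
  then have bij': "bij_betw (\<phi> ?U) ?S (strs ?R ?U)"
    using bij by (fastforce simp: bij_betw_def inj_on_def)
  have "wt ?R ?U = wt (comp_species F B) ?U" by (simp add: comp_species_def restr_species_def)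
  then have "((\<lambda>s. wt (comp_species F B) ?U (\<phi> ?U s)) has_sum fact n * fps_nth Y n) ?S"
    using R has_sum_reindex_bij_betw[OF bij', of "wt ?R ?U"]
    by (auto simp: has_egf_def dest: spec[of _ ?U])
  then show "(wt A ?U has_sum fact n * fps_nth Y n) ?S"
    by (rule has_sum_cong[THEN iffD1, rotated]) (use w in auto)
qed auto

section \<open>The asymptotic expansion\<close>

theorem theorem3p8:
  fixes A :: "(nat, 's) species" and B :: "(nat, 't) species" and m :: nat
  assumes "weighted_species A" and "weighted_species B" and "strs B {} = {}"
    and "gargantuan_species A"
  shows "(\<forall>\<phi>. species_iso \<phi> A (comp_species lin_species B) \<longrightarrow>
            asymp_expansion
              (\<lambda>n. measure_pmf.prob (random_structure A n)
                 {s \<in> strs A {1..n}.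
                    \<phi> {1..n} s \<in> strs (comp_species (restr_species m lin_species) B) {1..n}})
              (\<lambda>k. d_lin B k m)
              (\<lambda>k n. real (n choose k) * (total_weight A (n - k) / total_weight A n)))
       \<and> (\<forall>\<phi>. species_iso \<phi> A (comp_species cyc_species B) \<longrightarrow>
            asymp_expansion
              (\<lambda>n. measure_pmf.prob (random_structure A n)
                 {s \<in> strs A {1..n}.
                    \<phi> {1..n} s \<in> strs (comp_species (restr_species m cyc_species) B) {1..n}})
              (\<lambda>k. d_cyc B k m)
              (\<lambda>k n. real (n choose k) * (total_weight A (n - k) / total_weight A n)))"
proof -
  define X where "X = Abs_fps (\<lambda>n. total_weight B n / fact n)"
  have B: "has_egf B X" unfolding X_def by (rule has_egf_weighted_species[OF assms(2)])
  have X_nn: "fps_nth X n \<ge> 0" for n by (rule has_egf_nonneg[OF B])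
  have X0: "fps_nth X 0 = 0" by (simp add: X_def total_weight_def assms(3))
  have garg: "gargantuan (fps_nth Z)" if "has_egf A Z" for Z
    using assms(4) by (simp add: gargantuan_species_def has_egf_total_weight[OF that])
  \<comment> \<open>A single term of the composition supplies the constant
    \<open>1 / fps_nth C' m\<close>. Positivity is asked for m >= 1 only, since -log (1 - z) has no
    constant term; for m = 0 the constant 0 works, as the series 1 vanishes beyond index 0.\<close>
  have bound: "\<exists>C. \<forall>n\<ge>1. \<bar>fps_nth (X ^ m) n\<bar> \<le> C * fps_nth (C' oo X) n"
    if "\<And>m. fps_nth C' m \<ge> 0" "\<And>m. m \<ge> 1 \<Longrightarrow> fps_nth C' m > 0" for C' m
  proof (cases "m = 0")
    case False
    then have "fps_nth C' m > 0" using that(2) by simp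
    then have "\<bar>fps_nth (X ^ m) n\<bar> \<le> (1 / fps_nth C' m) * fps_nth (C' oo X) n" for n
      using fps_compose_term_le[OF X_nn X0 that(1), of m n] fps_power_nonneg[OF X_nn, of m n]
      by (simp add: field_simps)
    then show ?thesis by blast
  qed (auto intro: exI[of _ 0])
  show ?thesis
  proof (intro conjI allI impI)
    fix \<phi> assume iso: "species_iso \<phi> A (comp_species lin_species B)"
    let ?C = "Abs_fps (\<lambda>_. 1 :: real)"
    define Z where "Z = ?C oo X"
    have "has_egf (comp_species lin_species B) (Abs_fps (\<lambda>m. real (fact m) / fact m) oo X)"
      using card_linear_orders by (intro has_egf_comp B assms(3)) (auto simp: lin_species_def)
    then have A: "has_egf A Z" unfolding Z_def by (intro has_egf_iso[OF _ iso]) simp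
    \<comment> \<open>The term m = 1 of the composition has coefficient 1.\<close>
    have Z_ge: "fps_nth X n \<le> fps_nth Z n" for n
      using fps_compose_term_le[OF X_nn X0, of ?C 1 n] by (simp add: Z_def)
    have "has_egf (comp_species (restr_species m lin_species) B) (fps_const (real (fact m) / fact m) * X ^ m)"
      using card_linear_orders by (intro has_egf_comp_restr B assms(3)) (auto simp: lin_species_def)
    then have R: "has_egf (comp_species (restr_species m lin_species) B) (X ^ m)" by simp
    show "asymp_expansion
        (\<lambda>n. measure_pmf.prob (random_structure A n)
           {s \<in> strs A {1..n}. \<phi> {1..n} s \<in> strs (comp_species (restr_species m lin_species) B) {1..n}})
        (\<lambda>k. d_lin B k m)
        (\<lambda>k n. real (n choose k) * (total_weight A (n - k) / total_weight A n))"
    proof (rule asymp_expansion_ratio[OF A garg[OF A]])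
      show "expansion (fps_nth Z) r (fps_nth (X ^ m)) (fps_nth (of_nat m * X ^ (m - 1) * (1 - X)\<^sup>2))" for r
      proof (rule expansion_power[OF garg[OF A]])
        show "\<exists>C. \<forall>n\<ge>1. \<bar>fps_nth (X ^ m) n\<bar> \<le> C * fps_nth Z n" for m
          unfolding Z_def by (rule bound) auto
        show "expansion (fps_nth Z) r (fps_nth X) (fps_nth ((1 - X)\<^sup>2))" for r
          by (intro expansion_inverse_one_minus garg A X_nn Z_ge X0)
             (simp add: Z_def fps_geometric_compose[OF X0])
      qed
    qed (rule prob_comp_restr[OF iso A _ R] d_lin_eq[OF B], assumption?)+
  next
    fix \<phi> assume iso: "species_iso \<phi> A (comp_species cyc_species B)"
    let ?c = "\<lambda>m. if m = 0 then 0 else fact (m - 1) :: nat"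
    let ?C = "Abs_fps (\<lambda>m. (if m = 0 then 0 else fact (m - 1)) / fact m :: real)"
    define Z where "Z = ?C oo X"
    have cyc: "finite (strs cyc_species \<pi>) \<and> card (strs cyc_species \<pi>) = ?c (card \<pi>)" if "finite \<pi>" for \<pi> :: "nat set set"
    proof (cases "\<pi> = {}")
      case True
      then show ?thesis by (simp add: cyc_species_def cyclic_on_def)
    next
      case False
      then show ?thesis using card_cyclic_permutations[OF that False] that by (simp add: cyc_species_def)
    qed
    have "has_egf (comp_species cyc_species B) (Abs_fps (\<lambda>m. real (?c m) / fact m) oo X)"
      by (intro has_egf_comp[where c = ?c] B assms(3) cyc) (auto simp: cyc_species_def)
    moreover have "Abs_fps (\<lambda>m. real (?c m) / fact m) = ?C" by (rule fps_ext) simp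
    ultimately have A: "has_egf A Z" unfolding Z_def by (intro has_egf_iso[OF _ iso]) simp
    have Z_ge: "fps_nth X n \<le> fps_nth Z n" for n
      using fps_compose_term_le[OF X_nn X0, of ?C 1 n] by (simp add: Z_def)
    \<comment> \<open>This is 1 / m for m >= 1, and 0 for m = 0 because the empty set carries no
      cycle.\<close>
    define q where "q = real (?c m) / fact m"
    have R: "has_egf (comp_species (restr_species m cyc_species) B) (fps_const q * X ^ m)"
      unfolding q_def using cyc by (intro has_egf_comp_restr B assms(3)) (auto simp: cyc_species_def)
    \<comment> \<open>The factor m of the Leibniz rule cancels against 1 / m; the value 0 at m = 0
      matches the convention that the virtual species is then empty.\<close>
    have q: "q * real m = (if m = 0 then 0 else 1)"
      by (cases m) (simp_all add: q_def field_simps del: of_nat_Suc)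
    have D: "fps_const q * (of_nat m * X ^ (m - 1) * (1 - X)) = (if m = 0 then 0 else X ^ (m - 1) * (1 - X))"
    proof -
      have "fps_const q * (of_nat m * X ^ (m - 1) * (1 - X)) = fps_const (q * real m) * (X ^ (m - 1) * (1 - X))"
        by (simp add: fps_of_nat[symmetric] mult.assoc[symmetric] del: fps_of_nat)
      then show ?thesis unfolding q by (cases "m = 0") (simp_all only: fps_const_0_eq_0 fps_const_1_eq_1 simp_thms if_True if_False mult_zero_left mult_1)
    qed
    show "asymp_expansion
        (\<lambda>n. measure_pmf.prob (random_structure A n)
           {s \<in> strs A {1..n}. \<phi> {1..n} s \<in> strs (comp_species (restr_species m cyc_species) B) {1..n}})
        (\<lambda>k. d_cyc B k m)
        (\<lambda>k n. real (n choose k) * (total_weight A (n - k) / total_weight A n))"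
    proof (rule asymp_expansion_ratio[OF A garg[OF A]])
      have "expansion (fps_nth Z) r (fps_nth (X ^ m)) (fps_nth (of_nat m * X ^ (m - 1) * (1 - X)))" for r
      proof (rule expansion_power[OF garg[OF A]])
        show "\<exists>C. \<forall>n\<ge>1. \<bar>fps_nth (X ^ m) n\<bar> \<le> C * fps_nth Z n" for m
          unfolding Z_def by (rule bound) auto
        show "expansion (fps_nth Z) r (fps_nth X) (fps_nth (1 - X))" for r
          unfolding Z_def
          by (intro expansion_log garg A[unfolded Z_def] X_nn Z_ge[unfolded Z_def] X0 fps_log_compose_deriv)
      qed
      then show "expansion (fps_nth Z) r (fps_nth (fps_const q * X ^ m)) (fps_nth (fps_const q * (of_nat m * X ^ (m - 1) * (1 - X))))" for r
        by (rule expansion_cmult)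
      show "d_cyc B k m = fact k * fps_nth (fps_const q * (of_nat m * X ^ (m - 1) * (1 - X))) k" for k
        unfolding d_cyc_eq[OF B] D by simp
    qed (rule prob_comp_restr[OF iso A _ R])
  qed
qed

end
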